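(* Let $d\geq 1$ be an integer and let $w>2d-1$ be a rational number. Then there exist a strictly increasing sequence of positive integers $(k_j)_{j\geq 1}$ and a sequence $(\xi_j)_{j\geq 1}$ of elements of $\mathbb{F}_q((T^{-1}))$ such that, for every $j\geq 1$, $\xi_j$ is of Class IA, $\xi_j$ is algebraic over $\mathbb{F}_q(T)$ of degree $p^{k_j}+1$, and \[ w_1(\xi_j)=w_1^{*}(\xi_j)=w_2(\xi_j)=w_2^{*}(\xi_j)=\ldots=w_d(\xi_j)=w_d^{*}(\xi_j)=w . \]
   Context: Let $p$ be a prime and $q$ a power of $p$. $\mathbb{F}_q((T^{-1}))$ is the field of Laurent series $\xi=\sum_{n\geq N}a_nT^{-n}$ ($a_n\in\mathbb{F}_q$), with absolute value $|0|=0$ and $|\xi|=q^{-N}$ if $a_N\neq 0$; this absolute value is extended uniquely to an algebraic closure $\overline{\mathbb{F}_q(T)}$. The height $H(P)$ of $P\in(\mathbb{F}_q[T])[X]$ is the maximum of the absolute values of its coefficients. Every $\alpha\in\overline{\mathbb{F}_q(T)}$ is a root of a unique non-constant, irreducible, primitive $P\in(\mathbb{F}_q[T])[X]$ whose leading coefficient is monic in $T$ (its minimal polynomial); $H(\alpha)$ and $\deg\alpha$ denote the height and degree of this polynomial. For $\xi\in\mathbb{F}_q((T^{-1}))$ and $n\geq1$, $w_n(\xi)$ is the supremum of real $w$ such that $0<|P(\xi)|\leq H(P)^{-w}$ for infinitely many $P\in(\mathbb{F}_q[T])[X]$ of degree at most $n$, and $w_n^{*}(\xi)$ is the supremum of real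 $w^*$ such that $0<|\xi-\alpha|\leq H(\alpha)^{-w^*-1}$ for infinitely many $\alpha\in\overline{\mathbb{F}_q(T)}$ of degree at most $n$. An element $\alpha\in\mathbb{F}_q((T^{-1}))\setminus\mathbb{F}_q(T)$ is of Class IA if there exist an integer $s\geq0$ and $R,S,V,U\in\mathbb{F}_q[T]$ with $RU-SV\in\mathbb{F}_q^{\times}$ such that $\alpha=\dfrac{R\alpha^{p^s}+S}{V\alpha^{p^s}+U}$. *)

theory Defs
  imports
    "HOL-Computational_Algebra.Computational_Algebra"
    "HOL-Algebra.Algebraic_Closure_Type"
    "HOL-Library.Extended_Real"
    "HOL-Library.Cardinality"
begin

text \<open>
  The field $F_q((T^{-1}))$ is \<^typ>\<open>'a fls\<close> over a finite field \<^typ>\<open>'a\<close> with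
  $q$ elements, the formal variable \<^const>\<open>fls_X\<close> being $T^{-1}$; hence $T$ is
  \<^const>\<open>fls_X_inv\<close>. The ring $F_q[T]$ is \<^typ>\<open>'a poly\<close>, and $F_q[T][X]$ is
  \<^typ>\<open>'a poly poly\<close>.
\<close>

definition fls_of_T :: "'a::field poly \<Rightarrow> 'a fls" where
  "fls_of_T a = poly (map_poly fls_const a) fls_X_inv"

definition rat_funs :: "'a::field fls set" where
  "rat_funs = {fls_of_T a / fls_of_T b | a b. b \<noteq> 0}"

definition fls_abs :: "'a::{field,finite} fls \<Rightarrow> real" where
  "fls_abs x = (if x = 0 then 0 else real CARD('a) powi (- fls_subdegree x))"

definition poly_height :: "'a::{field,finite} poly poly \<Rightarrow> real" where
  "poly_height P = Max (range (\<lambda>i. fls_abs (fls_of_T (Polynomial.coeff P i))))"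

definition eval_fls :: "'a::field poly poly \<Rightarrow> 'a fls \<Rightarrow> 'a fls" where
  "eval_fls P x = poly (map_poly fls_of_T P) x"

definition eval_ac :: "'a::field poly poly \<Rightarrow> 'a fls alg_closure \<Rightarrow> 'a fls alg_closure" where
  "eval_ac P x = poly (map_poly (\<lambda>a. to_ac (fls_of_T a)) P) x"

text \<open>
  The algebraic closure of $F_q(T)$ is taken inside the algebraic closure of
  $F_q((T^{-1}))$, so that $\xi - \alpha$ makes sense for $\xi$ in $F_q((T^{-1}))$
  and $\alpha$ algebraic over $F_q(T)$. Clearing denominators, it consists of the roots of
  nonzero polynomials over $F_q[T]$.
\<close>

definition algebraic_T :: "'a::field fls alg_closure \<Rightarrow> bool" where
  "algebraic_T \<alpha> \<longleftrightarrow> (\<exists>P. P \<noteq> 0 \<and> eval_ac P \<alpha> = 0)"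

definition min_poly_T :: "'a::field fls alg_closure \<Rightarrow> 'a poly poly" where
  "min_poly_T \<alpha> = (THE P. Polynomial.degree P > 0 \<and> Factorial_Ring.irreducible P \<and>
     (\<forall>c. (\<forall>i. c dvd Polynomial.coeff P i) \<longrightarrow> is_unit c) \<and>
     Polynomial.lead_coeff (Polynomial.lead_coeff P) = 1 \<and> eval_ac P \<alpha> = 0)"

definition alg_degree :: "'a::field fls alg_closure \<Rightarrow> nat" where
  "alg_degree \<alpha> = Polynomial.degree (min_poly_T \<alpha>)"

definition alg_height :: "'a::{field,finite} fls alg_closure \<Rightarrow> real" where
  "alg_height \<alpha> = poly_height (min_poly_T \<alpha>)"

definition absolute_value :: "('b::field \<Rightarrow> real) \<Rightarrow> bool" where
  "absolute_value v \<longleftrightarrow>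
     (\<forall>x. v x \<ge> 0) \<and> (\<forall>x. v x = 0 \<longleftrightarrow> x = 0) \<and>
     (\<forall>x y. v (x * y) = v x * v y) \<and> (\<forall>x y. v (x + y) \<le> v x + v y)"

text \<open>
  The extension exists and is unique because $F_q((T^{-1}))$ is complete, so the choice
  operator picks the one possible value.
\<close>

definition ac_abs :: "'a::{field,finite} fls alg_closure \<Rightarrow> real" where
  "ac_abs = (SOME v. absolute_value v \<and> (\<forall>x. v (to_ac x) = fls_abs x))"

definition w_exp :: "nat \<Rightarrow> 'a::{field,finite} fls \<Rightarrow> ereal" where
  "w_exp n \<xi> = Sup {ereal w | w :: real.
     infinite {P. Polynomial.degree P \<le> n \<and> 0 < fls_abs (eval_fls P \<xi>) \<and>
                  fls_abs (eval_fls P \<xi>) \<le> poly_height P powr (- w)}}"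

definition w_star_exp :: "nat \<Rightarrow> 'a::{field,finite} fls \<Rightarrow> ereal" where
  "w_star_exp n \<xi> = Sup {ereal w | w :: real.
     infinite {\<alpha>. algebraic_T \<alpha> \<and> alg_degree \<alpha> \<le> n \<and> 0 < ac_abs (to_ac \<xi> - \<alpha>) \<and>
                  ac_abs (to_ac \<xi> - \<alpha>) \<le> alg_height \<alpha> powr (- w - 1)}}"

text \<open>
  The parameter \<open>p\<close> is the characteristic. The denominator below cannot vanish: otherwise
  the quotient, hence $\alpha$, would be $0$, which is a rational function.
\<close>

definition class_IA :: "nat \<Rightarrow> 'a::field fls \<Rightarrow> bool" where
  "class_IA p \<alpha> \<longleftrightarrow> \<alpha> \<notin> rat_funs \<and>
     (\<exists>(s::nat) R S V U. (\<exists>c. c \<noteq> 0 \<and> R * U - S * V = [:c:]) \<and>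
        \<alpha> = (fls_of_T R * \<alpha> ^ (p ^ s) + fls_of_T S) /
            (fls_of_T V * \<alpha> ^ (p ^ s) + fls_of_T U))"

end

theory Submission
  imports Defs
begin

hide_const (open) UnivPoly.coeff

text \<open>
  The element \<open>\<xi>\<close> is the continued fraction $[0; T^{e_0}, T^{e_1}, \ldots]$ whose exponents satisfy
  $e_{n+l} = p^k e_n$. Frobenius therefore maps \<open>\<xi>\<close> to a tail of itself, which gives the Class IA
  equation. The degrees of the convergents' denominators are $Y_n - Y_0$, where the ratios
  $Y_{n+1}/Y_n$ attain their maximum \<open>w\<close> infinitely often and never drop below
  $w(d-1)/(w-d)$; since $w > 2d-1$ this bound is smaller than \<open>w\<close>, which leaves enough room to reach a
  power of \<open>p\<close> after \<open>l\<close> steps.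

  Convergents give the lower bound for the exponents. For the upper bound, a polynomial of degree at
  most \<open>d\<close> is compared with its value at a convergent chosen according to its height; if this value
  vanishes, the linear factor is split off and the degree drops.

  For the degree of \<open>\<xi>\<close>, every root of $F(\xi + Z)/Z$, where \<open>F\<close> is the Class IA equation, has absolute
  value $q^{e/p^k}$ with \<open>e\<close> prime to \<open>p\<close>, and the product of the nonzero roots of $M(\xi + Z)$, with \<open>M\<close>
  the minimal polynomial of \<open>\<xi>\<close>, has absolute value in $q^{\bf Z}$. An extension of the absolute value
  to the algebraic closure is obtained from a subring that is maximal among those omitting \<open>T\<close>.
\<close>

section \<open>Ring embeddings and ultrametric absolute values\<close>

text \<open>The bound w(d-1)/(w-d) comes from testing a polynomial G of height q^h and degree at
  most d at the convergent P_N/Q_N. A nonzero value there is at least |Q_N|^(-d), and it persists at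
  \<xi> as soon as h + (d-1) deg Q_N < deg Q_(N+1). For the least such N > 0, failure at N-1 reads
  Y_N - (d-1) Y_(N-1) \<le> h + Y_0. To conclude d Y_N \<le> w (h + Y_0), which keeps |Q_N|^(-d)
  above a constant times H(G)^(-w), it suffices that d Y_N \<le> w (Y_N - (d-1) Y_(N-1)). The degree
  argument requires e = Y_l - Y_(l-1) to be prime to p. Since p divides Y_l = p^k Y_0, the last
  entry of a block is made congruent to 1 modulo p. Rationality of w lets one ratio per block equal
  w exactly. \<open>ac_abs\<close> is a choice, so nothing can be said about it before an extension
  is known to exist. Uniqueness is avoided: the bounds for \<open>w_star_exp\<close> use the
  triangle inequality alone, and the degree argument works with its own ultrametric
  extension.\<close>

locale comm_ring_embedding =
  fixes h :: "'a::idom \<Rightarrow> 'b::idom"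
  assumes hom_add: "h (x + y) = h x + h y"
    and hom_mult: "h (x * y) = h x * h y"
    and hom_one: "h 1 = 1"
    and hom_eq_0D: "h x = 0 \<Longrightarrow> x = 0"
begin

lemma hom_zero: "h 0 = 0"
  using hom_add[of 0 0] by (metis add.right_neutral add_left_cancel)

lemma hom_eq_0_iff: "h x = 0 \<longleftrightarrow> x = 0"
  using hom_zero hom_eq_0D by blast

lemma hom_uminus: "h (- x) = - h x"
  using hom_add[of x "- x"] by (simp add: hom_zero eq_neg_iff_add_eq_0 add.commute)

lemma hom_diff: "h (x - y) = h x - h y"
  using hom_add[of x "- y"] by (simp add: hom_uminus)

lemma hom_power: "h (x ^ n) = h x ^ n"
  by (induction n) (simp_all add: hom_one hom_mult)

lemma hom_sum: "h (sum f I) = (\<Sum>i\<in>I. h (f i))"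
  by (induction I rule: infinite_finite_induct) (simp_all add: hom_zero hom_add)

lemma map_poly_hom_add: "map_poly h (P + Q) = map_poly h P + map_poly h Q"
  by (intro poly_eqI) (simp add: coeff_map_poly hom_zero hom_add)

lemma map_poly_hom_diff: "map_poly h (P - Q) = map_poly h P - map_poly h Q"
  by (intro poly_eqI) (simp add: coeff_map_poly hom_zero hom_diff)

lemma map_poly_hom_mult: "map_poly h (P * Q) = map_poly h P * map_poly h Q"
  by (intro poly_eqI) (simp add: coeff_map_poly hom_zero hom_sum hom_mult coeff_mult)

lemma map_poly_hom_smult: "map_poly h (smult c P) = smult (h c) (map_poly h P)"
  by (intro poly_eqI) (simp add: coeff_map_poly hom_zero hom_mult)

lemma degree_map_poly_hom: "degree (map_poly h P) = degree P"
  by (rule degree_map_poly) (simp add: hom_eq_0_iff)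

lemma map_poly_hom_eq_0_iff: "map_poly h P = 0 \<longleftrightarrow> P = 0"
  by (rule map_poly_eq_0_iff) (simp_all add: hom_eq_0_iff)

lemma poly_map_poly_hom: "poly (map_poly h P) (h x) = h (poly P x)"
  by (induction P) (simp_all add: hom_zero map_poly_pCons hom_add hom_mult)

end

lemma fls_of_T_pCons: "fls_of_T (pCons c a) = fls_const c + fls_X_inv * fls_of_T a"
  by (simp add: fls_of_T_def map_poly_pCons)

text \<open>The variable of the series is T^(-1), so the coefficient of T^n sits at index -n.
  Injectivity of \<open>fls_of_T\<close> and its subdegree both come from this.\<close>

lemma fls_nth_fls_of_T: "fls_nth (fls_of_T a) k = (if k \<le> 0 then coeff a (nat (- k)) else 0)"
proof (induction a arbitrary: k)
  case 0
  then show ?case by (simp add: fls_of_T_def)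
next
  case (pCons c a)
  have *: "nat (- k) = Suc (nat (- 1 - k))" if "k < 0" using that by linarith
  show ?case
    by (auto simp: fls_of_T_pCons fls_X_inv_times_conv_shift pCons.IH * algebra_simps)
qed

interpretation fls_of_T: comm_ring_embedding "fls_of_T :: 'a::field poly \<Rightarrow> 'a fls"
proof
  interpret c: comm_ring_embedding "fls_const :: 'a \<Rightarrow> 'a fls"
    by standard (auto simp: fls_plus_const)
  fix x y :: "'a poly"
  show "fls_of_T (x + y) = fls_of_T x + fls_of_T y"
    by (simp add: fls_of_T_def c.map_poly_hom_add)
  show "fls_of_T (x * y) = fls_of_T x * fls_of_T y"
    by (simp add: fls_of_T_def c.map_poly_hom_mult)
  show "fls_of_T (1 :: 'a poly) = 1"
    by (simp add: fls_of_T_def)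
  assume "fls_of_T x = 0"
  then have "coeff x n = 0" for n
    using fls_nth_fls_of_T[of x "- int n"] by simp
  then show "x = 0" by (simp add: poly_eq_iff)
qed

interpretation to_ac: comm_ring_embedding "to_ac :: 'a::field \<Rightarrow> 'a alg_closure"
  by standard auto

interpretation ac_of_T: comm_ring_embedding "\<lambda>a :: 'a::field poly. to_ac (fls_of_T a)"
  by standard (auto simp: fls_of_T.hom_add fls_of_T.hom_mult fls_of_T.hom_one fls_of_T.hom_eq_0_iff)

lemma eval_ac_to_ac: "eval_ac P (to_ac x) = to_ac (eval_fls P x)"
proof -
  have "map_poly (\<lambda>a. to_ac (fls_of_T a)) P = map_poly to_ac (map_poly fls_of_T P)"
    by (simp add: map_poly_map_poly fls_of_T.hom_zero o_def)
  then show ?thesis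
    by (simp add: eval_ac_def eval_fls_def to_ac.poly_map_poly_hom)
qed

text \<open>Meant for \<open>fls_abs\<close> and for extensions of it to the algebraic closure.
  \<open>ac_abs\<close> is not treated as an instance: its definition only provides the triangle
  inequality.\<close>

locale ultrametric_abs =
  fixes v :: "'b::field \<Rightarrow> real"
  assumes abs_nonneg: "v x \<ge> 0"
    and abs_eq_0_iff: "v x = 0 \<longleftrightarrow> x = 0"
    and abs_mult: "v (x * y) = v x * v y"
    and abs_add_le: "v (x + y) \<le> max (v x) (v y)"
begin

lemma abs_zero: "v 0 = 0"
  by (simp add: abs_eq_0_iff)

lemma abs_pos_iff: "0 < v x \<longleftrightarrow> x \<noteq> 0"
  using abs_nonneg[of x] abs_eq_0_iff[of x] by linarith

lemma abs_one: "v 1 = 1"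
  using abs_mult[of 1 1] abs_eq_0_iff[of 1] by simp

lemma abs_uminus: "v (- x) = v x"
proof -
  have "v (- 1) * v (- 1) = 1" using abs_mult[of "- 1" "- 1"] by (simp add: abs_one)
  then have "v (- 1) = 1" using abs_nonneg[of "- 1"] by (simp add: square_eq_1_iff)
  then show ?thesis using abs_mult[of "- 1" x] by simp
qed

lemma abs_diff_le: "v (x - y) \<le> max (v x) (v y)"
  using abs_add_le[of x "- y"] by (simp add: abs_uminus)

lemma abs_power: "v (x ^ n) = v x ^ n"
  by (induction n) (simp_all add: abs_one abs_mult)

lemma abs_divide: "v (x / y) = v x / v y"
proof (cases "y = 0")
  case False
  then have "v x = v (x / y) * v y" by (simp flip: abs_mult)
  then show ?thesis using False by (simp add: abs_eq_0_iff)
qed (simp add: abs_zero)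

lemma abs_add_eq: 
  assumes "v x < v y"
  shows "v (x + y) = v y"
proof (rule antisym)
  show "v (x + y) \<le> v y" using abs_add_le[of x y] assms by simp
  show "v y \<le> v (x + y)" using abs_diff_le[of "x + y" x] assms by auto
qed

lemma abs_add_eq': "v y < v x \<Longrightarrow> v (x + y) = v x"
  using abs_add_eq[of y x] by (simp add: add.commute)

lemma abs_poly_le:
  assumes "\<And>i. v (coeff P i) \<le> H" "v x \<le> 1"
  shows "v (poly P x) \<le> H"
  using assms(1)
proof (induction P)
  case 0
  then show ?case by (metis coeff_0 poly_0)
next
  case (pCons a P)
  have "v (x * poly P x) \<le> 1 * H"
    unfolding abs_mult using pCons.prems[of "Suc _"] assms(2)
    by (intro mult_mono pCons.IH) (auto simp: abs_nonneg)
  then show ?case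
    using abs_add_le[of a "x * poly P x"] pCons.prems[of 0] by simp
qed

text \<open>Horner's scheme: the difference for \<open>pCons a P\<close> is x (P(x) - P(y)) + (x -
  y) P(y), and both parts obey the bound. The ultrametric inequality keeps the constant at
  \<open>H\<close>.\<close>

lemma abs_poly_diff_le:
  assumes "\<And>i. v (coeff P i) \<le> H" "v x \<le> 1" "v y \<le> 1"
  shows "v (poly P x - poly P y) \<le> H * v (x - y)"
  using assms(1)
proof (induction P)
  case 0
  have "0 \<le> H" using 0[of 0] by (simp add: abs_zero)
  then show ?case by (simp add: abs_zero abs_nonneg)
next
  case (pCons a P)
  have H: "v (coeff P i) \<le> H" for i using pCons.prems[of "Suc i"] by simp
  have "0 \<le> H" using H[of 0] abs_nonneg[of "coeff P 0"] by linarith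
  have "v (x * (poly P x - poly P y)) \<le> 1 * (H * v (x - y))"
    unfolding abs_mult using assms(2) pCons.IH[OF H] by (intro mult_mono) (auto simp: abs_nonneg)
  moreover have "v ((x - y) * poly P y) \<le> v (x - y) * H"
    unfolding abs_mult using abs_poly_le[OF H assms(3)] by (intro mult_left_mono) (auto simp: abs_nonneg)
  moreover have "poly (pCons a P) x - poly (pCons a P) y
      = x * (poly P x - poly P y) + (x - y) * poly P y"
    by (simp add: algebra_simps)
  ultimately show ?case
    using abs_add_le[of "x * (poly P x - poly P y)" "(x - y) * poly P y"] by (simp add: mult.commute)
qed

end

section \<open>Absolute value and completeness of the Laurent series field\<close>

lemma CARD_gt_1: "1 < real CARD('a::{field,finite})"
proof -
  have "card {0, 1 :: 'a} \<le> CARD('a)" by (rule card_mono) auto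
  then show ?thesis by simp
qed

lemma fls_abs_le_iff:
  "fls_abs (x :: 'a::{field,finite} fls) \<le> real CARD('a) powi (- n) \<longleftrightarrow> x = 0 \<or> n \<le> fls_subdegree x"
proof -
  note q = CARD_gt_1[where 'a = 'a]
  have "real CARD('a) powi (- fls_subdegree x) \<le> real CARD('a) powi (- n) \<longleftrightarrow> n \<le> fls_subdegree x"
    using power_int_strict_increasing[of "- n" "- fls_subdegree x" "real CARD('a)"]
      power_int_increasing[of "- fls_subdegree x" "- n" "real CARD('a)"] q by force
  then show ?thesis by (auto simp: fls_abs_def)
qed

interpretation fls: ultrametric_abs "fls_abs :: 'a::{field,finite} fls \<Rightarrow> real"
proof
  note q = CARD_gt_1[where 'a = 'a]
  fix x y :: "'a fls"
  show "0 \<le> fls_abs x" by (simp add: fls_abs_def)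
  show "fls_abs x = 0 \<longleftrightarrow> x = 0" using q by (simp add: fls_abs_def)
  show "fls_abs (x * y) = fls_abs x * fls_abs y"
    using q by (simp add: fls_abs_def power_int_add [symmetric] algebra_simps)
  show "fls_abs (x + y) \<le> max (fls_abs x) (fls_abs y)"
  proof (cases "x = 0 \<or> y = 0 \<or> x + y = 0")
    case False
    then have "min (fls_subdegree x) (fls_subdegree y) \<le> fls_subdegree (x + y)"
      by (intro fls_plus_subdegree) auto
    then have "fls_abs (x + y) \<le> real CARD('a) powi (- min (fls_subdegree x) (fls_subdegree y))"
      by (simp add: fls_abs_le_iff)
    then show ?thesis using False by (auto simp: fls_abs_def min_def max_def split: if_splits)
  qed (auto simp: fls_abs_def le_max_iff_disj)
qed

lemma fls_subdegree_fls_of_T: "fls_subdegree (fls_of_T a) = - int (degree a)"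
proof (cases "a = 0")
  case False
  then show ?thesis
    by (intro fls_subdegree_eqI) (auto simp: fls_nth_fls_of_T coeff_eq_0)
qed (simp add: fls_of_T.hom_zero)

lemma fls_abs_fls_of_T:
  "a \<noteq> 0 \<Longrightarrow> fls_abs (fls_of_T a :: 'a::{field,finite} fls) = real CARD('a) ^ degree a"
  by (simp add: fls_abs_def fls_subdegree_fls_of_T fls_of_T.hom_eq_0_iff)

lemma fls_abs_fls_of_T_ge_1: "a \<noteq> 0 \<Longrightarrow> 1 \<le> fls_abs (fls_of_T (a :: 'a::{field,finite} poly))"
  using CARD_gt_1[where 'a = 'a] by (simp add: fls_abs_fls_of_T)

text \<open>Completeness with an explicit rate. The coefficient at index i no longer changes once n
  > i, so the limit is read off along the diagonal.\<close>

lemma fls_abs_limit: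
  fixes c :: "nat \<Rightarrow> 'a::{field,finite} fls"
  assumes c: "\<And>n. fls_abs (c (Suc n) - c n) \<le> real CARD('a) powi (- int n)"
  obtains \<xi> where "\<And>n. fls_abs (\<xi> - c n) \<le> real CARD('a) powi (- int n)"
proof -
  have coeff_eq: "fls_nth (c (n + k)) i = fls_nth (c n) i" if "i < int n" for i n k
  proof (induction k)
    case (Suc k)
    have "fls_nth (c (Suc (n + k)) - c (n + k)) i = 0"
      using c[of "n + k"] that unfolding fls_abs_le_iff
      by (elim disjE) (auto simp del: fls_minus_nth)
    then show ?case using Suc by simp
  qed simp
  define f where "f i = fls_nth (c (nat (i + 1))) i" for i
  \<comment> \<open>At negative indices \<open>nat (i + 1)\<close> is 0, so \<open>f\<close> agrees
    there with the coefficients of \<open>c 0\<close> and inherits its lower bound.\<close>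
  have "\<exists>N. \<forall>n<N. f n = 0"
  proof (intro exI allI impI)
    fix n assume "n < min 0 (fls_subdegree (c 0))"
    then show "f n = 0" by (simp add: f_def)
  qed
  then have nth: "fls_nth (Abs_fls f) i = f i" for i
    by (rule nth_Abs_fls_ex_lower_bound)
  show ?thesis
  proof (rule that[of "Abs_fls f"])
    fix n
    have "fls_nth (Abs_fls f - c n) i = 0" if "i < int n" for i
    proof -
      have "fls_nth (c (nat (i + 1) + (n - nat (i + 1)))) i = fls_nth (c (nat (i + 1))) i"
        by (rule coeff_eq) simp
      then show ?thesis using that by (simp add: nth f_def)
    qed
    then show "fls_abs (Abs_fls f - c n) \<le> real CARD('a) powi (- int n)"
      unfolding fls_abs_le_iff by (metis fls_subdegree_geI)
  qed
qed

section \<open>Extension of the absolute value to the algebraic closure\<close>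

definition is_subring :: "'b::field set \<Rightarrow> bool" where
  "is_subring B \<longleftrightarrow> 1 \<in> B \<and> (\<forall>x\<in>B. \<forall>y\<in>B. x - y \<in> B \<and> x * y \<in> B)"

context
  fixes B :: "'b::field set"
  assumes B: "is_subring B"
begin

lemma subring_one: "1 \<in> B" and subring_diff: "x \<in> B \<Longrightarrow> y \<in> B \<Longrightarrow> x - y \<in> B"
  and subring_mult: "x \<in> B \<Longrightarrow> y \<in> B \<Longrightarrow> x * y \<in> B"
  using B by (auto simp: is_subring_def)

lemma subring_zero: "0 \<in> B"
  using subring_diff[OF subring_one subring_one] by simp

lemma subring_add: "x \<in> B \<Longrightarrow> y \<in> B \<Longrightarrow> x + y \<in> B"
  using subring_diff[of x "0 - y"] subring_diff[OF subring_zero, of y] by simp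

lemma subring_power: "x \<in> B \<Longrightarrow> x ^ n \<in> B"
  by (induction n) (auto intro: subring_one subring_mult)

lemma subring_sum: "(\<And>i. i \<in> I \<Longrightarrow> f i \<in> B) \<Longrightarrow> sum f I \<in> B"
  by (induction I rule: infinite_finite_induct) (auto intro: subring_zero subring_add)

lemma subring_poly: "(\<And>i. coeff P i \<in> B) \<Longrightarrow> x \<in> B \<Longrightarrow> poly P x \<in> B"
  unfolding poly_altdef by (intro subring_sum subring_mult subring_power)

lemma is_subring_adjoin: "is_subring {poly P x | P. \<forall>i. coeff P i \<in> B}"
  unfolding is_subring_def
proof (intro conjI ballI)
  have "\<forall>i. coeff (1 :: 'b poly) i \<in> B" by (auto simp: coeff_1 subring_one subring_zero)
  then show "1 \<in> {poly P x | P. \<forall>i. coeff P i \<in> B}" by (intro CollectI exI[of _ 1]) simp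
next
  fix a b assume "a \<in> {poly P x | P. \<forall>i. coeff P i \<in> B}" "b \<in> {poly P x | P. \<forall>i. coeff P i \<in> B}"
  then obtain P Q where PQ: "a = poly P x" "b = poly Q x" "\<And>i. coeff P i \<in> B" "\<And>i. coeff Q i \<in> B"
    by auto
  have "coeff (P * Q) i \<in> B" for i
    unfolding coeff_mult using PQ by (intro subring_sum subring_mult)
  then show "a * b \<in> {poly P x | P. \<forall>i. coeff P i \<in> B}" using PQ by (auto intro!: exI[of _ "P * Q"])
  show "a - b \<in> {poly P x | P. \<forall>i. coeff P i \<in> B}"
    using PQ by (auto intro!: exI[of _ "P - Q"] subring_diff)
qed

lemma subring_subset_adjoin: "B \<subseteq> {poly P x | P. \<forall>i. coeff P i \<in> B}"
proof
  fix b assume "b \<in> B"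
  then have "\<forall>i. coeff [:b:] i \<in> B" by (auto simp: coeff_pCons subring_zero split: nat.split)
  then show "b \<in> {poly P x | P. \<forall>i. coeff P i \<in> B}" by (force intro: exI[of _ "[:b:]"])
qed

lemma gen_in_adjoin: "x \<in> {poly P x | P. \<forall>i. coeff P i \<in> B}"
proof -
  have "\<forall>i. coeff [:0, 1:] i \<in> B"
    by (auto simp: coeff_pCons subring_zero subring_one split: nat.split)
  then show ?thesis by (force intro: exI[of _ "[:0, 1:]"])
qed

text \<open>The coefficients are reversed relative to a bound \<open>n\<close> that may exceed the
  degree of \<open>P\<close>; the descent on degrees below needs this freedom.\<close>

lemma poly_inverse_reflect:
  assumes "\<And>i. coeff P i \<in> B" "degree P \<le> n" "x \<noteq> 0"
  obtains Q where "\<And>i. coeff Q i \<in> B" "degree Q \<le> n" "x ^ n * poly P (inverse x) = poly Q x"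
proof (rule that)
  define Q where "Q = (\<Sum>i\<le>n. Polynomial.monom (coeff P i) (n - i))"
  show "degree Q \<le> n"
    unfolding Q_def by (intro degree_sum_le) (auto intro: order.trans[OF degree_monom_le])
  show "coeff Q i \<in> B" for i
    unfolding Q_def coeff_sum using assms(1) by (intro subring_sum) (auto simp: subring_zero)
  have "poly P (inverse x) = (\<Sum>i\<le>n. coeff P i * inverse x ^ i)"
    unfolding poly_altdef using assms(2) by (intro sum.mono_neutral_left) (auto simp: coeff_eq_0)
  also have "x ^ n * \<dots> = (\<Sum>i\<le>n. coeff P i * x ^ (n - i))"
    unfolding sum_distrib_left
    by (intro sum.cong) (use assms(3) in \<open>simp_all add: power_diff power_inverse divide_inverse mult_ac\<close>)
  finally show "x ^ n * poly P (inverse x) = poly Q x"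
    by (simp add: Q_def poly_sum poly_monom)
qed

end

text \<open>Chevalley's argument for a subring \<open>B\<close> maximal among those containing
  \<open>R\<close> and omitting \<open>t\<close>. If neither x nor 1/x were in \<open>B\<close>,
  then t would be a polynomial over \<open>B\<close> in x and also in 1/x. With both degrees
  minimal, the relation of smaller degree lowers the degree of the other one, a
  contradiction.\<close>

lemma valuation_ring_exists:
  fixes R :: "'b::field set"
  assumes R: "is_subring R" and t: "t \<notin> R" "inverse t \<in> R"
  obtains B where "is_subring B" "R \<subseteq> B" "t \<notin> B" "\<And>x. x \<in> B \<or> inverse x \<in> B"
proof -
  define SS where "SS = {B. is_subring B \<and> R \<subseteq> B \<and> t \<notin> B}"
  have "\<exists>U\<in>SS. \<forall>Y\<in>SS. U \<subseteq> Y \<longrightarrow> Y = U"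
  proof (rule subset_Zorn_nonempty)
    show "SS \<noteq> {}" using R t by (auto simp: SS_def)
    fix C assume C: "C \<noteq> {}" "subset.chain SS C"
    then have CA: "C \<subseteq> SS" and chain: "\<And>Z Y. Z \<in> C \<Longrightarrow> Y \<in> C \<Longrightarrow> Z \<subseteq> Y \<or> Y \<subseteq> Z"
      by (auto simp: subset_chain_def)
    have "is_subring (\<Union>C)"
      unfolding is_subring_def
    proof (intro conjI ballI)
      show "1 \<in> \<Union>C" using C(1) CA by (auto simp: SS_def is_subring_def)
    next
      fix x y assume "x \<in> \<Union>C" "y \<in> \<Union>C"
      then obtain Z where Z: "Z \<in> C" "x \<in> Z" "y \<in> Z" using chain by blast
      then have "is_subring Z" using CA by (auto simp: SS_def)
      then show "x - y \<in> \<Union>C" "x * y \<in> \<Union>C" using Z by (auto simp: is_subring_def)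
    qed
    then show "\<Union>C \<in> SS" using CA C(1) by (auto simp: SS_def)
  qed
  then obtain B where "B \<in> SS" and maxB: "\<And>Z. Z \<in> SS \<Longrightarrow> B \<subseteq> Z \<Longrightarrow> Z = B" by blast
  then have B: "is_subring B" "R \<subseteq> B" "t \<notin> B" by (auto simp: SS_def)
  define \<pi> where "\<pi> = inverse t"
  have \<pi>: "\<pi> \<in> B" using t B by (auto simp: \<pi>_def)
  have "t \<noteq> 0" using subring_zero[OF B(1)] B(3) by auto
  then have t\<pi>: "t * \<pi> = 1" by (simp add: \<pi>_def)
  \<comment> \<open>By maximality B[x], which properly contains \<open>B\<close>, must contain
    \<open>t\<close>.\<close>
  have adjoin: "\<exists>P. t = poly P x \<and> (\<forall>i. coeff P i \<in> B)" if "x \<notin> B" for x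
  proof (rule ccontr)
    assume "\<not> ?thesis"
    then have "{poly P x | P. \<forall>i. coeff P i \<in> B} \<in> SS"
      using subring_subset_adjoin[OF B(1), of x] is_subring_adjoin[OF B(1), of x] B(2)
      by (auto simp: SS_def)
    from maxB[OF this subring_subset_adjoin[OF B(1)]] show False
      using gen_in_adjoin[OF B(1), of x] that by simp
  qed
  \<comment> \<open>If u = 1 - \<pi> c were not invertible in \<open>B\<close>, then t would lie in
    B[1/u], hence u^n t in \<open>B\<close> for some n. Since u^n = 1 - \<pi> e with e in
    \<open>B\<close>, and t \<pi> = 1, this puts t - e, and so t, into \<open>B\<close>.\<close>
  have unit: "inverse (1 - \<pi> * c) \<in> B" if c: "c \<in> B" for c
  proof (rule ccontr)
    define u where "u = 1 - \<pi> * c"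
    assume "inverse (1 - \<pi> * c) \<notin> B"
    then obtain P where P: "t = poly P (inverse u)" "\<And>i. coeff P i \<in> B"
      using adjoin u_def by metis
    have "u \<noteq> 0"
    proof
      assume "u = 0"
      then have "t * (\<pi> * c) = t" by (simp add: u_def)
      then have "c = t" using t\<pi> by (simp add: mult.assoc[symmetric])
      then show False using c B(3) by simp
    qed
    obtain Q where Q: "\<And>i. coeff Q i \<in> B" "u ^ degree P * t = poly Q u"
      using poly_inverse_reflect[OF B(1) P(2) order_refl \<open>u \<noteq> 0\<close>] P(1) by metis
    have u: "u \<in> B" using c \<pi> B(1) by (auto simp: u_def intro: subring_diff subring_mult subring_one)
    have un: "\<exists>e\<in>B. u ^ n = 1 - \<pi> * e" for n
    proof (induction n)
      case 0
      show ?case by (rule bexI[of _ 0]) (auto simp: subring_zero[OF B(1)])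
    next
      case (Suc n)
      then obtain e where "e \<in> B" "u ^ n = 1 - \<pi> * e" by auto
      have "u ^ Suc n = u ^ n - \<pi> * (c * u ^ n)" by (simp add: u_def left_diff_distrib mult.assoc)
      then have "u ^ Suc n = 1 - \<pi> * (e + c * u ^ n)"
        using \<open>u ^ n = 1 - \<pi> * e\<close> by (simp add: distrib_left)
      moreover have "e + c * u ^ n \<in> B"
        using \<open>e \<in> B\<close> c u by (intro subring_add[OF B(1)] subring_mult[OF B(1)] subring_power[OF B(1)])
      ultimately show ?case by blast
    qed
    then obtain e where e: "e \<in> B" "u ^ degree P = 1 - \<pi> * e" by blast
    have "poly Q u = t - t * \<pi> * e" using Q(2) e(2) by (simp add: algebra_simps)
    then have "t = poly Q u + e" using t\<pi> by simp
    moreover have "poly Q u \<in> B" using Q(1) u by (rule subring_poly[OF B(1)])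
    ultimately show False using subring_add[OF B(1)] e(1) B(3) by metis
  qed
  define E where "E x n \<longleftrightarrow> (\<exists>P. t = poly P x \<and> (\<forall>i. coeff P i \<in> B) \<and> degree P \<le> n)" for x n
  have not_E_0: "\<not> E x 0" for x
  proof
    assume "E x 0"
    then obtain P where P: "t = poly P x" "coeff P 0 \<in> B" "degree P = 0" by (auto simp: E_def)
    from degree_eq_zeroE[OF P(3)] obtain c where "P = [:c:]" by blast
    then show False using P B(3) by simp
  qed
  \<comment> \<open>Write t = c + Q'(1/x)/x with c the constant term. Multiplication by \<pi> gives
    1 - \<pi> c = \<pi> Q'(1/x)/x, whose left side is invertible in \<open>B\<close>. After
    multiplication by x^n this expresses x^n by lower powers of x, and these replace the top term of
    \<open>P\<close>.\<close>
  have reduce: "E x (n - 1)" if x: "x \<noteq> 0" and n: "E x n" and m: "E (inverse x) m" "m \<le> n" for x n m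
  proof -
    have "0 < n" "0 < m" using not_E_0 n m by (metis gr0I)+
    obtain P where P: "t = poly P x" "\<And>i. coeff P i \<in> B" "degree P \<le> n"
      using n unfolding E_def by blast
    obtain Q where Q: "t = poly Q (inverse x)" "\<And>i. coeff Q i \<in> B" "degree Q \<le> m"
      using m(1) unfolding E_def by blast
    obtain c Q' where Q': "Q = pCons c Q'" by (cases Q)
    have c: "c \<in> B" "\<And>i. coeff Q' i \<in> B" using Q(2)[of 0] Q(2)[of "Suc _"] by (auto simp: Q')
    have "degree Q' \<le> n - 1" using Q(3) m(2) by (auto simp: Q' split: if_splits)
    then obtain S where S: "\<And>i. coeff S i \<in> B" "degree S \<le> n - 1"
      "x ^ (n - 1) * poly Q' (inverse x) = poly S x"
      using poly_inverse_reflect[OF B(1) c(2) _ x] by metis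
    define z where "z = inverse (1 - \<pi> * c)"
    have z: "z \<in> B" using unit c by (simp add: z_def)
    have "1 - \<pi> * c \<noteq> 0"
    proof
      assume "1 - \<pi> * c = 0"
      then have "t * (\<pi> * c) = t" by simp
      then have "c = t" using t\<pi> by (simp add: mult.assoc[symmetric])
      then show False using c B(3) by simp
    qed
    moreover have "1 - \<pi> * c = \<pi> * (inverse x * poly Q' (inverse x))"
    proof -
      have "\<pi> * t = \<pi> * (c + inverse x * poly Q' (inverse x))" using Q(1) by (simp add: Q')
      then have "1 = \<pi> * c + \<pi> * (inverse x * poly Q' (inverse x))"
        using t\<pi> by (simp add: distrib_left mult.commute)
      then show ?thesis by (metis add_diff_cancel_left')
    qed
    ultimately have z1: "z * (\<pi> * (inverse x * poly Q' (inverse x))) = 1"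
      unfolding z_def by (metis left_inverse)
    have "x ^ n = x ^ n * (z * (\<pi> * (inverse x * poly Q' (inverse x))))"
      unfolding z1 by simp
    then have "x ^ n = z * \<pi> * (x ^ n * inverse x * poly Q' (inverse x))"
      by (simp only: mult_ac)
    also have "x ^ n * inverse x = x ^ (n - 1)"
      using \<open>0 < n\<close> x by (simp add: power_diff divide_inverse)
    finally have xn: "x ^ n = poly (smult (z * \<pi>) S) x" using S(3) by simp
    define P0 where "P0 = P - Polynomial.monom (coeff P n) n"
    have P0: "degree P0 \<le> n - 1"
    proof (rule degree_le, intro allI impI)
      fix i assume "n - 1 < i"
      then show "coeff P0 i = 0" using P(3) by (cases "i = n") (auto simp: P0_def coeff_eq_0)
    qed
    define P1 where "P1 = P0 + smult (coeff P n) (smult (z * \<pi>) S)"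
    have "poly P1 x = poly P0 x + coeff P n * x ^ n" by (simp add: P1_def xn)
    then have "poly P1 x = t" using P(1) by (simp add: P0_def poly_monom)
    moreover have "degree P1 \<le> n - 1"
      unfolding P1_def using P0 S(2) by (intro degree_add_le) (auto intro: order.trans[OF degree_smult_le])
    moreover have "coeff P1 i \<in> B" for i
      unfolding P1_def P0_def using P(2) S(1) z \<pi>
      by (auto intro!: subring_add[OF B(1)] subring_diff[OF B(1)] subring_mult[OF B(1)] subring_zero[OF B(1)])
    ultimately show ?thesis by (auto simp: E_def)
  qed
  show ?thesis
  proof (rule that[OF B])
    fix x
    show "x \<in> B \<or> inverse x \<in> B"
    proof (rule ccontr)
      assume not: "\<not> ?thesis"
      then have x: "x \<noteq> 0" using subring_zero[OF B(1)] by auto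
      have ex: "\<exists>n. E x n" "\<exists>n. E (inverse x) n" using not adjoin unfolding E_def by blast+
      define n m where "n = (LEAST n. E x n)" and "m = (LEAST n. E (inverse x) n)"
      have nm: "E x n" "E (inverse x) m" using ex by (auto simp: n_def m_def intro: LeastI_ex)
      then have "0 < n" "0 < m" using not_E_0 by (metis gr0I)+
      moreover have "\<not> E x (n - 1)" "\<not> E (inverse x) (m - 1)"
        using not_less_Least[of "n - 1" "E x"] not_less_Least[of "m - 1" "E (inverse x)"]
          \<open>0 < n\<close> \<open>0 < m\<close> by (auto simp: n_def m_def)
      ultimately show False
        using reduce[of x n m] reduce[of "inverse x" m n] nm x by (cases "m \<le> n") auto
    qed
  qed
qed

section \<open>Units and vanishing sums in a valuation ring\<close>

locale valuation_subring =
  fixes B :: "'b::field set"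
  assumes subring: "is_subring B" and total: "x \<in> B \<or> inverse x \<in> B"
begin

definition unit :: "'b \<Rightarrow> bool" where
  "unit x \<longleftrightarrow> x \<noteq> 0 \<and> x \<in> B \<and> inverse x \<in> B"

lemmas closed = subring_add[OF subring] subring_mult[OF subring] subring_power[OF subring]
  subring_one[OF subring] subring_zero[OF subring]

lemma unit_one: "unit 1"
  by (simp add: unit_def closed)

lemma unit_mult: "unit x \<Longrightarrow> unit y \<Longrightarrow> unit (x * y)"
  by (auto simp: unit_def closed)

lemma unit_inverse: "unit x \<Longrightarrow> unit (inverse x)"
  by (auto simp: unit_def)

lemma unit_power: "unit x \<Longrightarrow> unit (x ^ n)"
  by (induction n) (auto simp: unit_one unit_mult)

text \<open>The non-units of a valuation ring form an ideal. Of x/y and y/x one lies in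
  \<open>B\<close>; if it is x/y and x + y were a unit, then 1/y = (x/y + 1)/(x + y) would lie in
  \<open>B\<close>.\<close>

lemma nonunit_add:
  assumes "x \<in> B" "\<not> unit x" "y \<in> B" "\<not> unit y"
  shows "\<not> unit (x + y)"
proof -
  have *: "\<not> unit (x + y)" if "x / y \<in> B" "y \<in> B" "\<not> unit y" "y \<noteq> 0" for x y
  proof
    assume "unit (x + y)"
    have nz: "x + y \<noteq> 0" using \<open>unit (x + y)\<close> by (simp add: unit_def)
    have "inverse y = inverse (x + y) * (x / y + 1)"
      using nz that(4) by (simp add: field_simps)
    moreover have "inverse (x + y) * (x / y + 1) \<in> B"
      using \<open>unit (x + y)\<close> that by (intro closed) (auto simp: unit_def)
    ultimately show False using that by (auto simp: unit_def)
  qed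
  show ?thesis
  proof (cases "x = 0 \<or> y = 0")
    case False
    have "x / y \<in> B \<or> y / x \<in> B" using total[of "x / y"] by simp
    then show ?thesis using *[of x y] *[of y x] assms False by (auto simp: add.commute)
  qed (use assms in auto)
qed

lemma nonunit_sum:
  "(\<And>i. i \<in> I \<Longrightarrow> f i \<in> B \<and> \<not> unit (f i)) \<Longrightarrow> sum f I \<in> B \<and> \<not> unit (sum f I)"
proof (induction I rule: infinite_finite_induct)
  case (insert i I)
  then show ?case using nonunit_add[of "f i" "sum f I"] closed by auto
qed (auto simp: unit_def closed)

text \<open>Divisibility in a valuation ring is a total preorder, so a finite family has a member of
  largest value.\<close>

lemma finite_dominant:
  "finite I \<Longrightarrow> I \<noteq> {} \<Longrightarrow> (\<And>i. i \<in> I \<Longrightarrow> z i \<noteq> 0) \<Longrightarrow> \<exists>j\<in>I. \<forall>i\<in>I. z i / z j \<in> B"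
proof (induction I rule: finite_ne_induct)
  case (singleton i)
  then show ?case by (auto simp: closed)
next
  case (insert k I)
  then obtain j where j: "j \<in> I" "\<And>i. i \<in> I \<Longrightarrow> z i / z j \<in> B" by auto
  show ?case
  proof (cases "z k / z j \<in> B")
    case True
    then show ?thesis using j by auto
  next
    case False
    then have jk: "z j / z k \<in> B" using total[of "z k / z j"] by simp
    have "z i / z k \<in> B" if "i \<in> I" for i
    proof -
      have "z i / z k = (z i / z j) * (z j / z k)" using insert.prems[of j] j by simp
      then show ?thesis using j(2)[OF that] jk closed(2) by metis
    qed
    then show ?thesis using insert.prems[of k] by (intro bexI[of _ k]) (auto simp: closed)
  qed
qed

text \<open>In a vanishing sum the largest value occurs at least twice: otherwise division by the
  dominant term \<open>z j\<close> writes -1 as a sum of non-units. Applied to an algebraic equation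
  of x, this ties a power of x to an element of the base field.\<close>

lemma sum_eq_0_imp_unit_quotient:
  assumes I: "finite I" "I \<noteq> {}" and nz: "\<And>i. i \<in> I \<Longrightarrow> z i \<noteq> 0" and sum: "sum z I = 0"
  obtains i j where "i \<in> I" "j \<in> I" "i \<noteq> j" "unit (z i / z j)"
proof -
  obtain j where j: "j \<in> I" "\<And>i. i \<in> I \<Longrightarrow> z i / z j \<in> B"
    using finite_dominant[of I z] I nz by blast
  have "\<exists>i\<in>I - {j}. unit (z i / z j)"
  proof (rule ccontr)
    assume "\<not> ?thesis"
    then have "\<not> unit (\<Sum>i\<in>I - {j}. z i / z j)"
      using nonunit_sum[of "I - {j}" "\<lambda>i. z i / z j"] j(2) by auto
    moreover have "(\<Sum>i\<in>I - {j}. z i / z j) = (sum z I - z j) / z j"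
      using I(1) j(1) by (simp add: sum_diff1 sum_divide_distrib[symmetric])
    then have "(\<Sum>i\<in>I - {j}. z i / z j) = - 1"
      using sum nz[OF j(1)] by simp
    moreover have "unit (- 1)"
      using subring_diff[OF subring closed(5) closed(4)] by (simp add: unit_def)
    ultimately show False by simp
  qed
  then show ?thesis using j(1) that by blast
qed

end

section \<open>The absolute value attached to the valuation ring\<close>

lemma fls_abs_ge_CARD:
  "1 < fls_abs (x :: 'a::{field,finite} fls) \<Longrightarrow> real CARD('a) \<le> fls_abs x"
  using fls_abs_le_iff[of x 0] CARD_gt_1[where 'a = 'a]
    power_int_increasing[of 1 "- fls_subdegree x" "real CARD('a)"]
  by (auto simp: fls_abs_def split: if_splits)

lemma fls_abs_X_inv: "fls_abs (fls_X_inv :: 'a::{field,finite} fls) = real CARD('a)"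
  by (simp add: fls_abs_def)

lemma ultrametric_extension_exists:
  obtains v :: "'a::{field,finite} fls alg_closure \<Rightarrow> real"
  where "ultrametric_abs v" "\<And>x. v (to_ac x) = fls_abs x"
proof -
  define R where "R = (to_ac :: 'a fls \<Rightarrow> _) ` {x. fls_abs x \<le> 1}"
  define t where "t = (to_ac :: 'a fls \<Rightarrow> _) fls_X_inv"
  have "is_subring R"
    unfolding is_subring_def
  proof (intro conjI ballI)
    show "1 \<in> R" unfolding R_def by (rule image_eqI[of _ _ 1]) (auto simp: fls.abs_one)
    fix x y assume "x \<in> R" "y \<in> R"
    then obtain a b where ab: "x = to_ac a" "y = to_ac b" "fls_abs a \<le> 1" "fls_abs b \<le> 1"
      by (auto simp: R_def)
    show "x - y \<in> R" unfolding R_def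
      using fls.abs_diff_le[of a b] ab by (intro image_eqI[of _ _ "a - b"]) auto
    show "x * y \<in> R" unfolding R_def
      using ab by (intro image_eqI[of _ _ "a * b"]) (auto simp: fls.abs_mult mult_le_one fls.abs_nonneg)
  qed
  moreover have "t \<notin> R" using CARD_gt_1[where 'a = 'a] by (auto simp: R_def t_def fls_abs_X_inv)
  moreover have "inverse t \<in> R"
  proof -
    have "fls_abs (inverse fls_X_inv :: 'a fls) = 1 / fls_abs (fls_X_inv :: 'a fls)"
      using fls.abs_divide[of 1 fls_X_inv] by (simp add: fls.abs_one inverse_eq_divide)
    then have "fls_abs (inverse fls_X_inv :: 'a fls) \<le> 1"
      using CARD_gt_1[where 'a = 'a] by (simp add: fls_abs_X_inv)
    then show ?thesis by (auto simp: R_def t_def simp flip: to_ac_inverse)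
  qed
  ultimately obtain B where B: "is_subring B" "R \<subseteq> B" "t \<notin> B" "\<And>x. x \<in> B \<or> inverse x \<in> B"
    using valuation_ring_exists by blast
  interpret B: valuation_subring B by standard (use B in auto)
  have integral: "to_ac a \<in> B" if "fls_abs a \<le> 1" for a using that B(2) by (auto simp: R_def)
  \<comment> \<open>\<open>B\<close> meets the Laurent series in the ring of integers only: values
    lie in q^Z, so |c| > 1 means |c| \<ge> q = |T|. Then T/c is integral, and c in \<open>B\<close>
    would force T into \<open>B\<close>.\<close>
  have le_1: "fls_abs c \<le> 1" if "to_ac c \<in> B" for c
  proof (rule ccontr)
    assume "\<not> fls_abs c \<le> 1"
    then have c: "real CARD('a) \<le> fls_abs c" using fls_abs_ge_CARD by force
    then have "c \<noteq> 0" using CARD_gt_1[where 'a = 'a] by (auto simp: fls.abs_zero)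
    have "fls_abs (fls_X_inv / c) \<le> 1"
      using c CARD_gt_1[where 'a = 'a] by (simp add: fls.abs_divide fls_abs_X_inv field_simps)
    then have "to_ac c * to_ac (fls_X_inv / c) \<in> B" using that integral B.closed by blast
    then have "to_ac (c * (fls_X_inv / c)) \<in> B" by (simp only: to_ac_mult)
    then show False using \<open>c \<noteq> 0\<close> B(3) by (simp add: t_def)
  qed
  have unit_abs: "fls_abs c = 1" if "B.unit (to_ac c)" for c
  proof -
    have "to_ac (inverse c) \<in> B" "c \<noteq> 0" using that by (auto simp: B.unit_def)
    then have "fls_abs (1 / c) \<le> 1" using le_1 by (simp add: inverse_eq_divide)
    then have "1 \<le> fls_abs c"
      using \<open>c \<noteq> 0\<close> by (simp add: fls.abs_divide fls.abs_one fls.abs_pos_iff field_simps)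
    then show ?thesis using le_1[of c] that by (auto simp: B.unit_def)
  qed
  \<comment> \<open>Two terms of an algebraic equation of x have a unit quotient, so a positive
    power of x is, up to a unit, an element of the base field.\<close>
  have ex_unit: "\<exists>n a. 0 < n \<and> a \<noteq> 0 \<and> B.unit (x ^ n * to_ac a)" if x: "x \<noteq> 0" for x
  proof -
    obtain p where p: "p \<noteq> 0" "poly (map_poly to_ac p) x = 0"
      using alg_closure_algebraic by blast
    define z where "z i = to_ac (coeff p i) * x ^ i" for i
    define I where "I = {i. i \<le> degree p \<and> coeff p i \<noteq> 0}"
    have "sum z I = sum z {..degree p}"
      by (rule sum.mono_neutral_left) (auto simp: I_def z_def)
    also have "\<dots> = poly (map_poly to_ac p) x"
      by (simp add: poly_altdef to_ac.degree_map_poly_hom coeff_map_poly z_def)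
    finally have "sum z I = 0" using p by simp
    moreover have "finite I" "I \<noteq> {}" using p by (auto simp: I_def intro: exI[of _ "degree p"])
    moreover have "\<And>i. i \<in> I \<Longrightarrow> z i \<noteq> 0" using x by (auto simp: I_def z_def)
    ultimately obtain i j where ij: "i \<in> I" "j \<in> I" "i \<noteq> j" "B.unit (z i / z j)"
      using B.sum_eq_0_imp_unit_quotient by metis
    have *: "\<exists>n a. 0 < n \<and> a \<noteq> 0 \<and> B.unit (x ^ n * to_ac a)"
      if ij: "i \<in> I" "j \<in> I" "j < i" "B.unit (z i / z j)" for i j
    proof (intro exI conjI)
      have "z i / z j = x ^ (i - j) * to_ac (coeff p i / coeff p j)"
        using ij(3) x by (simp add: z_def power_diff mult.commute)
      then show "B.unit (x ^ (i - j) * to_ac (coeff p i / coeff p j))" using ij by simp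
    qed (use ij in \<open>auto simp: I_def\<close>)
    show ?thesis
      using *[of i j] *[of j i] ij B.unit_inverse[OF ij(4)] by (cases "j < i") auto
  qed
  \<comment> \<open>The value is forced: if x^n a is a unit, then |x|^n |a| has to be 1.\<close>
  define v where "v x = (if x = 0 then 0 else
      (SOME r. \<exists>n a. 0 < n \<and> a \<noteq> 0 \<and> B.unit (x ^ n * to_ac a) \<and> 0 < r \<and> r ^ n * fls_abs a = 1))" for x
  \<comment> \<open>The value does not depend on the relation. Raising two relations to each other's
    exponent and dividing cancels x and leaves a unit a^m / b^n of the base field, which has
    absolute value 1.\<close>
  have v: "0 < v x \<and> v x ^ n * fls_abs a = 1"
    if x: "x \<noteq> 0" and n: "0 < n" "a \<noteq> 0" "B.unit (x ^ n * to_ac a)" for x n a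
  proof -
    have a: "0 < fls_abs a" using n by (simp add: fls.abs_pos_iff)
    define r where "r = root n (1 / fls_abs a)"
    have r: "0 < r" "r ^ n * fls_abs a = 1" using a n by (auto simp: r_def)
    have "\<exists>n a. 0 < n \<and> a \<noteq> 0 \<and> B.unit (x ^ n * to_ac a) \<and> 0 < v x \<and> v x ^ n * fls_abs a = 1"
      unfolding v_def using x r n
      by (simp only: if_False, intro someI[where P = "\<lambda>r. \<exists>n a. 0 < n \<and> a \<noteq> 0 \<and> B.unit (x ^ n * to_ac a) \<and> 0 < r \<and> r ^ n * fls_abs a = 1" and x = r]) auto
    then obtain m b where m: "0 < m" "b \<noteq> 0" "B.unit (x ^ m * to_ac b)" "0 < v x" "v x ^ m * fls_abs b = 1"
      by blast
    have "B.unit ((x ^ n * to_ac a) ^ m * inverse ((x ^ m * to_ac b) ^ n))"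
      using B.unit_mult[OF B.unit_power[OF n(3)] B.unit_inverse[OF B.unit_power[OF m(3)]]] .
    also have "(x ^ n * to_ac a) ^ m * inverse ((x ^ m * to_ac b) ^ n) = to_ac (a ^ m / b ^ n)"
      using x by (simp add: power_mult_distrib power_mult[symmetric] mult.commute[of m n] divide_inverse)
    finally have "fls_abs a ^ m = fls_abs b ^ n"
      using unit_abs[of "a ^ m / b ^ n"] m(2) by (simp add: fls.abs_divide fls.abs_power fls.abs_pos_iff fls.abs_eq_0_iff field_simps)
    then have "r ^ (n * m) * fls_abs b ^ n = 1"
      using arg_cong[OF r(2), of "\<lambda>x. x ^ m"] by (simp add: power_mult_distrib power_mult)
    moreover have "v x ^ (n * m) * fls_abs b ^ n = 1"
      using arg_cong[OF m(5), of "\<lambda>x. x ^ n"] by (simp add: power_mult_distrib power_mult mult.commute[of n m])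
    ultimately have "r ^ (n * m) = v x ^ (n * m)"
      using m(2) by (metis fls.abs_eq_0_iff mult_right_cancel power_not_zero)
    then have "r = v x" using r m n by (simp add: power_eq_iff_eq_base)
    then show ?thesis using r by simp
  qed
  have v_pos: "0 < v x" if "x \<noteq> 0" for x
    using ex_unit[OF that] v[OF that] by blast
  have "v 0 = 0" by (simp add: v_def)
  then have v_0: "v x = 0 \<longleftrightarrow> x = 0" "0 \<le> v x" for x
    using v_pos[of x] by (cases "x = 0"; simp)+
  have v_mult: "v (x * y) = v x * v y" for x y
  proof (cases "x = 0 \<or> y = 0")
    case False
    then obtain n a m b where n: "0 < n" "a \<noteq> 0" "B.unit (x ^ n * to_ac a)"
      and m: "0 < m" "b \<noteq> 0" "B.unit (y ^ m * to_ac b)"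
      using ex_unit[of x] ex_unit[of y] by blast
    have "B.unit ((x ^ n * to_ac a) ^ m * (y ^ m * to_ac b) ^ n)"
      using B.unit_mult[OF B.unit_power[OF n(3)] B.unit_power[OF m(3)]] .
    also have "(x ^ n * to_ac a) ^ m * (y ^ m * to_ac b) ^ n = (x * y) ^ (n * m) * to_ac (a ^ m * b ^ n)"
      by (simp add: power_mult_distrib power_mult[symmetric] mult_ac)
    finally have xy: "0 < v (x * y) \<and> v (x * y) ^ (n * m) * fls_abs (a ^ m * b ^ n) = 1"
      using False n m by (intro v) auto
    note vx = v[OF _ n] and vy = v[OF _ m]
    have "(v x * v y) ^ (n * m) * fls_abs (a ^ m * b ^ n)
        = (v x ^ n * fls_abs a) ^ m * (v y ^ m * fls_abs b) ^ n"
      by (simp add: power_mult_distrib power_mult[symmetric] fls.abs_mult fls.abs_power mult_ac)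
    also have "\<dots> = 1" using vx vy False by simp
    finally have "(v x * v y) ^ (n * m) = v (x * y) ^ (n * m)"
      using xy n m by (metis mult_right_cancel mult_zero_right zero_neq_one)
    then show ?thesis using n m v_0(2) by (simp add: power_eq_iff_eq_base)
  qed (auto simp: v_0)
  have v_to_ac: "v (to_ac c) = fls_abs c" for c
  proof (cases "c = 0")
    case False
    then have "v (to_ac c) ^ 1 * fls_abs (inverse c) = 1"
      using v[of "to_ac c" 1 "inverse c"] by (simp add: B.unit_one)
    then show ?thesis
      using False fls.abs_divide[of 1 c] by (simp add: fls.abs_one inverse_eq_divide fls.abs_eq_0_iff field_simps)
  qed (simp add: v_0 fls.abs_zero)
  \<comment> \<open>This identifies \<open>B\<close> with the unit ball. Closure of \<open>B\<close>
    under addition then yields the ultrametric inequality after scaling by the larger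
    element.\<close>
  have v_le_1: "v x \<le> 1 \<longleftrightarrow> x \<in> B" for x
  proof (cases "x = 0")
    case True
    then show ?thesis using v_0(1)[of 0] B.closed by simp
  next
    case False
    then obtain n a where n: "0 < n" "a \<noteq> 0" "B.unit (x ^ n * to_ac a)" using ex_unit by blast
    note vx = v[OF False n]
    show ?thesis
    proof
      assume "x \<in> B"
      show "v x \<le> 1"
      proof (rule ccontr)
        assume "\<not> v x \<le> 1"
        then have "1 < v x ^ n" using n by (simp add: one_less_power)
        then have a: "fls_abs a < 1"
          using vx n(2) by (metis fls.abs_pos_iff less_irrefl mult.commute mult_le_cancel_left1 mult.left_neutral mult_strict_right_mono not_le order_less_imp_le)
        have "inverse (to_ac a) = x ^ n * inverse (x ^ n * to_ac a)" using False by simp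
        also have "\<dots> \<in> B" using n(3) \<open>x \<in> B\<close> by (intro B.closed) (auto simp: B.unit_def)
        finally have "B.unit (to_ac a)" using integral[of a] a n(2) by (simp add: B.unit_def)
        then show False using unit_abs a by fastforce
      qed
    next
      assume "v x \<le> 1"
      then have "v x ^ n \<le> 1" using v_0 by (simp add: power_le_one)
      then have "1 \<le> fls_abs a"
        using vx fls.abs_nonneg[of a] mult_right_mono[of "v x ^ n" 1 "fls_abs a"] by simp
      then have "fls_abs (inverse a) \<le> 1"
        using fls.abs_divide[of 1 a] by (simp add: inverse_eq_divide fls.abs_one)
      then have "to_ac (inverse a) \<in> B" by (rule integral)
      moreover have "x ^ n * to_ac a \<in> B" using n(3) by (simp add: B.unit_def)
      ultimately have "(x ^ n * to_ac a) * to_ac (inverse a) \<in> B" using B.closed(2) by blast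
      then have xn: "x ^ n \<in> B" using n(2) by (simp add: mult.assoc)
      \<comment> \<open>Valuation rings are closed under roots: otherwise 1/x is in
        \<open>B\<close>, and so is x = x^n (1/x)^(n-1).\<close>
      show "x \<in> B"
      proof (rule ccontr)
        assume "x \<notin> B"
        then have "inverse x \<in> B" using B.total by blast
        then have "x ^ n * inverse x ^ (n - 1) \<in> B" using xn B.closed by blast
        moreover have "x ^ n = x * x ^ (n - 1)" using n(1) by (cases n) auto
        then have "x ^ n * inverse x ^ (n - 1) = x"
          using False by (simp add: power_inverse mult.assoc)
        ultimately show False using \<open>x \<notin> B\<close> by simp
      qed
    qed
  qed
  have v_add: "v (x + y) \<le> v y" if "v x \<le> v y" for x y
  proof (cases "y = 0")
    case True
    then show ?thesis using that v_0 by (metis add.right_neutral)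
  next
    case False
    then have "v y * v (x / y) = v x" by (simp flip: v_mult)
    then have "v (x / y) \<le> 1" using that v_0[of y] False
      by (metis mult.right_neutral mult_le_cancel_left_pos order_le_less)
    then have "v (x / y + 1) \<le> 1" using B.closed by (simp add: v_le_1)
    moreover have "x + y = y * (x / y + 1)" using False by (simp add: field_simps)
    then have "v (x + y) = v y * v (x / y + 1)" by (simp only: v_mult)
    ultimately show ?thesis using v_0(2)[of y] by (simp add: mult_left_le)
  qed
  have "ultrametric_abs v"
  proof
    show "v (x + y) \<le> max (v x) (v y)" for x y
      using v_add[of x y] v_add[of y x] by (cases "v x \<le> v y") (auto simp: add.commute)
  qed (use v_0 v_mult in auto)
  then show ?thesis using v_to_ac that by blast
qed

text \<open>The choice in \<open>ac_abs\<close> is meaningful only once some extension exists. All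
  later reasoning about \<open>ac_abs\<close> rests on these two facts.\<close>

lemma ac_abs_absolute_value: "absolute_value (ac_abs :: 'a::{field,finite} fls alg_closure \<Rightarrow> real)"
  and ac_abs_to_ac: "ac_abs (to_ac x :: 'a fls alg_closure) = fls_abs x"
proof -
  obtain v :: "'a fls alg_closure \<Rightarrow> real"
    where v: "ultrametric_abs v" "\<And>x. v (to_ac x) = fls_abs x"
    using ultrametric_extension_exists by blast
  interpret ultrametric_abs v by (rule v)
  have "v (x + y) \<le> v x + v y" for x y
    using abs_add_le[of x y] abs_nonneg[of x] abs_nonneg[of y] by simp
  then have "absolute_value v \<and> (\<forall>x. v (to_ac x) = fls_abs x)"
    using v(2) by (auto simp: absolute_value_def abs_nonneg abs_eq_0_iff abs_mult)
  then have "absolute_value (ac_abs :: 'a fls alg_closure \<Rightarrow> real) \<and>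
      (\<forall>x :: 'a fls. ac_abs (to_ac x) = fls_abs x)"
    unfolding ac_abs_def by (rule someI[where P = "\<lambda>v. absolute_value v \<and> (\<forall>x. v (to_ac x) = fls_abs x)"])
  then show "absolute_value (ac_abs :: 'a fls alg_closure \<Rightarrow> real)"
    "ac_abs (to_ac x :: 'a fls alg_closure) = fls_abs x" by auto
qed

section \<open>Minimal polynomials and heights\<close>

definition primitive_poly :: "'a::field poly poly \<Rightarrow> bool" where
  "primitive_poly P \<longleftrightarrow> (\<forall>c. (\<forall>i. c dvd coeff P i) \<longrightarrow> is_unit c)"

lemma field_poly_ex_prime_divisor:
  fixes c :: "'a::field poly"
  assumes "c \<noteq> 0" "\<not> is_unit c"
  obtains \<pi> where "prime_elem \<pi>" "\<pi> dvd c"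
proof -
  have "\<exists>\<pi>. Factorial_Ring.irreducible \<pi> \<and> \<pi> dvd c"
    using assms
  proof (induction "degree c" arbitrary: c rule: less_induct)
    case less
    show ?case
    proof (cases "Factorial_Ring.irreducible c")
      case False
      then obtain a b where ab: "c = a * b" "\<not> is_unit a" "\<not> is_unit b"
        using less.prems by (auto simp: Factorial_Ring.irreducible_def)
      then have "a \<noteq> 0" "b \<noteq> 0" using less.prems by auto
      then have "0 < degree b" using ab(3) by (simp add: is_unit_iff_degree)
      then have "degree a < degree c" using \<open>a \<noteq> 0\<close> \<open>b \<noteq> 0\<close> by (simp add: ab(1) degree_mult_eq)
      then show ?thesis using less.hyps[of a] \<open>a \<noteq> 0\<close> ab by (metis dvd_mult2)
    qed auto
  qed
  then show ?thesis using that field_poly_irreducible_imp_prime by blast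
qed

text \<open>Gauss's lemma, proved by cancelling the primes dividing \<open>c\<close> one at a time.\<close>

lemma primitive_dvd_smultD:
  fixes A F :: "'a::field poly poly"
  assumes A: "primitive_poly A"
  shows "c \<noteq> 0 \<Longrightarrow> A dvd smult c F \<Longrightarrow> A dvd F"
proof (induction "degree c" arbitrary: c rule: less_induct)
  case less
  show ?case
  proof (cases "is_unit c")
    case True
    then obtain d where "1 = c * d" by (auto elim: dvdE)
    moreover have "A dvd smult d (smult c F)" using less.prems(2) by (rule dvd_smult)
    ultimately show ?thesis by (simp add: mult.commute)
  next
    case False
    then obtain \<pi> c' where \<pi>: "prime_elem \<pi>" and c': "c = \<pi> * c'"
      using field_poly_ex_prime_divisor[OF less.prems(1)] by (metis dvdE)
    obtain S where S: "smult c F = A * S" using less.prems(2) by (auto elim: dvdE)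
    have "[:\<pi>:] dvd A * S"
      unfolding S[symmetric] c' by (rule dvdI[of _ _ "smult c' F"]) (simp add: mult.commute)
    moreover have "\<not> [:\<pi>:] dvd A"
    proof
      assume "[:\<pi>:] dvd A"
      then have "is_unit \<pi>" using A by (auto simp: primitive_poly_def const_poly_dvd_iff)
      then show False using \<pi> by (simp add: prime_elem_def)
    qed
    ultimately have "[:\<pi>:] dvd S"
      using prime_elem_dvd_multD[OF lift_prime_elem_poly[OF \<pi>]] by blast
    then obtain S' where S': "S = smult \<pi> S'" by (auto elim!: dvdE)
    have "\<pi> \<noteq> 0" using \<pi> by auto
    have "smult \<pi> (smult c' F) = smult \<pi> (A * S')" using S by (simp add: c' S')
    then have "smult c' F = A * S'" using \<open>\<pi> \<noteq> 0\<close> smult_cancel by blast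
    moreover have "c' \<noteq> 0" using less.prems(1) c' by auto
    moreover have "0 < degree \<pi>" using \<pi> \<open>\<pi> \<noteq> 0\<close> by (auto simp: prime_elem_def is_unit_iff_degree)
    then have "degree c' < degree c" using \<open>\<pi> \<noteq> 0\<close> \<open>c' \<noteq> 0\<close> by (simp add: c' degree_mult_eq)
    ultimately show ?thesis using less.hyps by auto
  qed
qed

lemma eval_ac_add: "eval_ac (P + Q) \<alpha> = eval_ac P \<alpha> + eval_ac Q \<alpha>"
  by (simp add: eval_ac_def ac_of_T.map_poly_hom_add)

lemma eval_ac_mult: "eval_ac (P * Q) \<alpha> = eval_ac P \<alpha> * eval_ac Q \<alpha>"
  by (simp add: eval_ac_def ac_of_T.map_poly_hom_mult)

lemma eval_ac_smult: "eval_ac (smult c P) \<alpha> = to_ac (fls_of_T c) * eval_ac P \<alpha>"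
  by (simp add: eval_ac_def ac_of_T.map_poly_hom_smult)

text \<open>Only the degree is minimised, which fixes \<open>A\<close> up to a factor from F_q(T).
  Primitivity and the normalised leading coefficient single out the minimal polynomial.\<close>

definition minimal_vanishing :: "'a::field poly poly \<Rightarrow> 'a fls alg_closure \<Rightarrow> bool" where
  "minimal_vanishing A \<alpha> \<longleftrightarrow> A \<noteq> 0 \<and> eval_ac A \<alpha> = 0 \<and>
     (\<forall>F. F \<noteq> 0 \<longrightarrow> eval_ac F \<alpha> = 0 \<longrightarrow> degree A \<le> degree F)"

lemma minimal_vanishing_degree_pos:
  assumes "minimal_vanishing A \<alpha>"
  shows "0 < degree A"
proof (rule ccontr)
  assume "\<not> 0 < degree A"
  then obtain c where "A = [:c:]" by (auto elim: degree_eq_zeroE)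
  then show False using assms
    by (simp add: minimal_vanishing_def eval_ac_def map_poly_pCons fls_of_T.hom_zero fls_of_T.hom_eq_0_iff)
qed

text \<open>Pseudo-division by \<open>A\<close> leaves a remainder that vanishes at \<alpha> and has
  smaller degree, hence is 0. So \<open>A\<close> divides c F with c in F_q[T], and Gauss's lemma
  removes c.\<close>

lemma primitive_minimal_vanishing_dvd:
  assumes A: "primitive_poly A" "minimal_vanishing A \<alpha>" and F: "eval_ac F \<alpha> = 0"
  shows "A dvd F"
proof -
  obtain S R where SR: "pseudo_divmod F A = (S, R)" by fastforce
  define c where "c = lead_coeff A ^ (Suc (degree F) - degree A)"
  have "A \<noteq> 0" using A by (simp add: minimal_vanishing_def)
  note pd = pseudo_divmod[OF this SR, folded c_def]
  have "eval_ac R \<alpha> = 0"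
    using arg_cong[OF pd(1), of "\<lambda>P. eval_ac P \<alpha>"] F A
    by (simp add: eval_ac_add eval_ac_mult eval_ac_smult minimal_vanishing_def)
  then have "R = 0" using pd(2) A by (auto simp: minimal_vanishing_def)
  then have "A dvd smult c F" using pd(1) by simp
  moreover have "c \<noteq> 0" using \<open>A \<noteq> 0\<close> by (simp add: c_def)
  ultimately show ?thesis using primitive_dvd_smultD[OF A(1)] by blast
qed

text \<open>In a factorisation of \<open>A\<close> some factor vanishes at \<alpha> and has full
  degree by minimality; the other one is a constant dividing all coefficients, hence a unit. A rival
  polynomial is a unit multiple of \<open>A\<close>, and the normalisation makes that unit
  1.\<close>

lemma min_poly_T_eqI:
  assumes A: "primitive_poly A" "minimal_vanishing A \<alpha>" and monic: "lead_coeff (lead_coeff A) = 1"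
  shows "min_poly_T \<alpha> = A"
  unfolding min_poly_T_def primitive_poly_def[symmetric]
proof (rule the_equality, intro conjI)
  have A': "A \<noteq> 0" "eval_ac A \<alpha> = 0" "\<And>F. F \<noteq> 0 \<Longrightarrow> eval_ac F \<alpha> = 0 \<Longrightarrow> degree A \<le> degree F"
    using A by (auto simp: minimal_vanishing_def)
  show deg: "0 < degree A" using A by (rule_tac minimal_vanishing_degree_pos)
  have factor: "is_unit V" if UV: "A = U * V" "eval_ac U \<alpha> = 0" for U V
  proof -
    have "U \<noteq> 0" "V \<noteq> 0" using UV A' by auto
    then have "degree A = degree U + degree V" by (simp add: UV(1) degree_mult_eq)
    then have "degree V = 0" using A'(3)[OF \<open>U \<noteq> 0\<close> UV(2)] by simp
    then obtain c where c: "V = [:c:]" by (auto elim: degree_eq_zeroE)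
    have "c dvd coeff A i" for i by (simp add: UV(1) c)
    then show ?thesis using A(1) by (simp add: primitive_poly_def c is_unit_const_poly_iff)
  qed
  show "Factorial_Ring.irreducible A"
  proof (rule Factorial_Ring.irreducibleI)
    show "\<not> is_unit A" using deg by (auto simp: is_unit_poly_iff)
    fix U V assume UV: "A = U * V"
    then have "eval_ac U \<alpha> = 0 \<or> eval_ac V \<alpha> = 0" using A'(2) by (simp add: eval_ac_mult)
    then show "is_unit U \<or> is_unit V" using factor[of U V] factor[of V U] UV by (auto simp: mult.commute)
  qed (use A' in auto)
  show "primitive_poly A" "lead_coeff (lead_coeff A) = 1" "eval_ac A \<alpha> = 0" using A monic A' by auto
  fix P assume P: "0 < degree P \<and> Factorial_Ring.irreducible P \<and> primitive_poly P \<and>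
    lead_coeff (lead_coeff P) = 1 \<and> eval_ac P \<alpha> = 0"
  then obtain U where U: "P = A * U" using primitive_minimal_vanishing_dvd[OF A] by (metis dvdE)
  then have "is_unit A \<or> is_unit U" using P by (auto dest: Factorial_Ring.irreducibleD)
  then have "is_unit U" using deg by (auto simp: is_unit_poly_iff)
  then obtain u where u: "U = [:[:u:]:]"
    by (auto simp: is_unit_poly_iff)
  have "lead_coeff (lead_coeff P) = lead_coeff (lead_coeff A) * u"
    unfolding U u by (simp add: lead_coeff_mult)
  then have "u = 1" using P monic by simp
  then show "P = A" by (simp add: U u one_pCons[symmetric])
qed

lemma ex_primitive_minimal_vanishing:
  assumes "algebraic_T \<alpha>"
  obtains A where "primitive_poly A" "minimal_vanishing A \<alpha>" "lead_coeff (lead_coeff A) = 1"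
proof -
  define S where "S = {P. P \<noteq> 0 \<and> eval_ac P \<alpha> = 0}"
  obtain P0 where P0: "P0 \<in> S" "\<And>F. F \<in> S \<Longrightarrow> degree P0 \<le> degree F"
    using assms ex_has_least_nat[of "\<lambda>P. P \<in> S" _ degree] by (auto simp: S_def algebraic_T_def)
  \<comment> \<open>A second minimisation, now over the degree in T of the leading coefficient. It
    yields primitivity, because dividing out a non-unit common factor would lower that
    degree.\<close>
  define S' where "S' = {P \<in> S. degree P = degree P0}"
  obtain P where P: "P \<in> S'" "\<And>F. F \<in> S' \<Longrightarrow> degree (lead_coeff P) \<le> degree (lead_coeff F)"
    using P0(1) ex_has_least_nat[of "\<lambda>P. P \<in> S'" P0 "\<lambda>P. degree (lead_coeff P)"] by (auto simp: S'_def)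
  define u where "u = lead_coeff (lead_coeff P)"
  have "P \<noteq> 0" using P(1) by (simp add: S'_def S_def)
  then have "u \<noteq> 0" by (simp add: u_def)
  define A where "A = smult [:inverse u:] P"
  have A: "A \<noteq> 0" "eval_ac A \<alpha> = 0" "degree A = degree P0" "lead_coeff A = smult (inverse u) (lead_coeff P)"
    using P(1) \<open>u \<noteq> 0\<close> by (auto simp: A_def S'_def S_def eval_ac_smult)
  show ?thesis
  proof (rule that)
    show "minimal_vanishing A \<alpha>" using A P0 by (auto simp: minimal_vanishing_def S_def)
    show "lead_coeff (lead_coeff A) = 1"
      using \<open>u \<noteq> 0\<close> by (simp add: A(4) u_def[symmetric])
    show "primitive_poly A"
      unfolding primitive_poly_def
    proof (intro allI impI)
      fix c assume "\<forall>i. c dvd coeff A i"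
      then have "[:c:] dvd A" by (simp add: const_poly_dvd_iff)
      then obtain A' where A': "A = smult c A'" by (auto elim!: dvdE)
      then have "c \<noteq> 0" "A' \<noteq> 0" using A(1) by auto
      then have "A' \<in> S'"
        using A by (auto simp: S'_def S_def A' eval_ac_smult fls_of_T.hom_eq_0_iff)
      then have "degree (lead_coeff P) \<le> degree (lead_coeff A')" by (rule P(2))
      moreover have "degree (lead_coeff P) = degree (lead_coeff A)"
        using \<open>u \<noteq> 0\<close> by (simp add: A(4))
      moreover have "degree (lead_coeff A) = degree c + degree (lead_coeff A')"
        using \<open>c \<noteq> 0\<close> \<open>A' \<noteq> 0\<close> by (simp add: A' degree_mult_eq)
      ultimately show "is_unit c" using \<open>c \<noteq> 0\<close> by (simp add: is_unit_iff_degree)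
    qed
  qed
qed

lemma min_poly_T_props:
  assumes "algebraic_T \<alpha>"
  shows "primitive_poly (min_poly_T \<alpha>)" "minimal_vanishing (min_poly_T \<alpha>) \<alpha>"
  using ex_primitive_minimal_vanishing[OF assms] min_poly_T_eqI by metis+

text \<open>The Bezout relation makes every common divisor of the coefficients a unit, and degree 1
  is minimal because nonzero constants do not vanish.\<close>

lemma linear_primitive_minimal_vanishing:
  fixes a b :: "'a::field poly"
  assumes "b \<noteq> 0" "a * r + b * s = 1"
  shows "primitive_poly [:- a, b:]" "minimal_vanishing [:- a, b:] (to_ac (fls_of_T a / fls_of_T b))"
proof -
  show "primitive_poly [:- a, b:]"
    unfolding primitive_poly_def
  proof (intro allI impI)
    fix c assume c: "\<forall>i. c dvd coeff [:- a, b:] i"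
    have "c dvd a" "c dvd b" using c[rule_format, of 0] c[rule_format, of 1] by auto
    then have "c dvd a * r + b * s" by (intro dvd_add dvd_mult2)
    then show "is_unit c" by (simp add: assms)
  qed
  have "degree [:- a, b:] \<le> degree F"
    if F: "F \<noteq> 0" "eval_ac F (to_ac (fls_of_T a / fls_of_T b)) = 0" for F
  proof (rule ccontr)
    assume "\<not> ?thesis"
    then have "degree F = 0" using assms by simp
    then obtain e where "F = [:e:]" by (auto elim: degree_eq_zeroE)
    then show False using F
      by (simp add: eval_ac_def map_poly_pCons fls_of_T.hom_zero fls_of_T.hom_eq_0_iff)
  qed
  then show "minimal_vanishing [:- a, b:] (to_ac (fls_of_T a / fls_of_T b))"
    using assms(1)
    by (auto simp: minimal_vanishing_def eval_ac_def map_poly_pCons fls_of_T.hom_zero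
        fls_of_T.hom_uminus fls_of_T.hom_eq_0_iff)
qed

section \<open>Heights: attainment, finiteness, linear factors\<close>

lemma
  fixes P :: "'a::{field,finite} poly poly"
  shows coeff_le_poly_height: "fls_abs (fls_of_T (coeff P i)) \<le> poly_height P"
    and poly_height_attained: "\<exists>i. fls_abs (fls_of_T (coeff P i)) = poly_height P"
proof -
  let ?f = "\<lambda>i. fls_abs (fls_of_T (coeff P i))"
  \<comment> \<open>The maximum runs over infinitely many indices, but all values beyond the degree
    are 0.\<close>
  have "range ?f \<subseteq> insert 0 (?f ` {..degree P})"
    by (auto simp: image_iff fls_of_T.hom_zero fls.abs_zero)
      (metis atMost_iff coeff_eq_0 fls.abs_zero fls_of_T.hom_zero leI)
  then have fin: "finite (range ?f)" by (rule finite_subset) simp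
  show "?f i \<le> poly_height P"
    unfolding poly_height_def using fin by (intro Max_ge) auto
  have "poly_height P \<in> range ?f"
    unfolding poly_height_def using fin by (intro Max_in) auto
  then show "\<exists>i. ?f i = poly_height P" by (metis (lifting) imageE)
qed

lemma poly_height_ge_1:
  assumes "P \<noteq> 0"
  shows "1 \<le> poly_height P"
  using fls_abs_fls_of_T_ge_1[of "lead_coeff P"] coeff_le_poly_height[of P "degree P"] assms by simp

lemma poly_height_eq_power:
  fixes P :: "'a::{field,finite} poly poly"
  assumes "P \<noteq> 0"
  obtains h :: nat where "poly_height P = real CARD('a) ^ h"
proof -
  obtain i where i: "fls_abs (fls_of_T (coeff P i)) = poly_height P"
    using poly_height_attained by blast
  then have "coeff P i \<noteq> 0" using poly_height_ge_1[OF assms] by (auto simp: fls_of_T.hom_zero fls.abs_zero)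
  then show ?thesis using that[of "degree (coeff P i)"] i by (simp add: fls_abs_fls_of_T)
qed

lemma finite_poly_bounded_coeffs:
  assumes "finite S"
  shows "finite {P :: 'b::zero poly. degree P \<le> n \<and> (\<forall>i. coeff P i \<in> S)}"
proof (rule finite_subset)
  show "{P. degree P \<le> n \<and> (\<forall>i. coeff P i \<in> S)} \<subseteq> Poly ` {xs. set xs \<subseteq> S \<and> length xs = Suc n}"
  proof
    fix P assume P: "P \<in> {P. degree P \<le> n \<and> (\<forall>i. coeff P i \<in> S)}"
    have "P = Poly (map (coeff P) [0..<Suc n])"
    proof (rule poly_eqI)
      fix i
      show "coeff P i = coeff (Poly (map (coeff P) [0..<Suc n])) i"
        unfolding coeff_Poly_eq nth_default_def using P
        by (cases "i < Suc n") (auto simp del: upt_Suc simp: coeff_eq_0)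
    qed
    then show "P \<in> Poly ` {xs. set xs \<subseteq> S \<and> length xs = Suc n}"
      using P by (intro image_eqI[of _ _ "map (coeff P) [0..<Suc n]"]) (auto simp del: upt_Suc)
  qed
  show "finite (Poly ` {xs. set xs \<subseteq> S \<and> length xs = Suc n})"
    using finite_lists_length_eq[OF assms] by simp
qed

lemma finite_bounded_height:
  "finite {P :: 'a::{field,finite} poly poly. degree P \<le> n \<and> poly_height P \<le> H}"
proof -
  note q = CARD_gt_1[where 'a = 'a]
  obtain N where N: "H < real CARD('a) ^ N" using real_arch_pow[OF q] by blast
  \<comment> \<open>Membership in \<open>UNIV\<close> gives this set the shape of
    \<open>finite_poly_bounded_coeffs\<close>, which is applied to polynomials in T over the finite
    field and then to polynomials in X over \<open>S\<close>.\<close>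
  define S where "S = {a :: 'a poly. degree a \<le> N \<and> (\<forall>i. coeff a i \<in> UNIV)}"
  have "finite S" unfolding S_def by (rule finite_poly_bounded_coeffs) simp
  moreover have "coeff P i \<in> S" if "poly_height P \<le> H" for P i
  proof (cases "coeff P i = 0")
    case False
    then have "real CARD('a) ^ degree (coeff P i) < real CARD('a) ^ N"
      using coeff_le_poly_height[of P i] that N by (simp add: fls_abs_fls_of_T)
    then show ?thesis using q by (simp add: S_def)
  qed (simp add: S_def)
  ultimately show ?thesis
    by (intro finite_subset[OF _ finite_poly_bounded_coeffs[of S n]]) auto
qed

text \<open>At an index i where R attains its height, coefficient i + 1 of the product is b R_i - a
  R_(i+1), and the first term dominates because |a| < |b|. Splitting off such a factor divides the
  height by at least |b|.\<close>

lemma poly_height_linear_mult_ge: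
  fixes a b :: "'a::{field,finite} poly"
  assumes "fls_abs (fls_of_T a) < fls_abs (fls_of_T b)"
  shows "fls_abs (fls_of_T b) * poly_height R \<le> poly_height ([:- a, b:] * R)"
proof -
  obtain i where i: "fls_abs (fls_of_T (coeff R i)) = poly_height R" using poly_height_attained by blast
  show ?thesis
  proof (cases "R = 0")
    case True
    then show ?thesis using i by (simp add: fls_of_T.hom_zero fls.abs_zero)
  next
    case False
    have "fls_abs (fls_of_T (- a * coeff R (Suc i))) < fls_abs (fls_of_T (b * coeff R i))"
      unfolding fls_of_T.hom_mult fls_of_T.hom_uminus fls.abs_mult fls.abs_uminus i
      using coeff_le_poly_height[of R "Suc i"] poly_height_ge_1[OF False] assms
      by (intro order.strict_trans1[OF mult_left_mono mult_strict_right_mono]) (auto simp: fls.abs_nonneg)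
    moreover have "coeff ([:- a, b:] * R) (Suc i) = - a * coeff R (Suc i) + b * coeff R i"
      by simp
    ultimately have "fls_abs (fls_of_T (coeff ([:- a, b:] * R) (Suc i))) = fls_abs (fls_of_T (b * coeff R i))"
      by (simp only: fls_of_T.hom_add fls.abs_add_eq)
    then show ?thesis
      using coeff_le_poly_height[of "[:- a, b:] * R" "Suc i"] by (simp only: fls_of_T.hom_mult fls.abs_mult i)
  qed
qed

text \<open>Clearing denominators makes b^n P(a/b) a nonzero element of F_q[T], whose absolute value
  is at least 1.\<close>

lemma fls_abs_eval_at_fraction_ge:
  fixes a b :: "'a::{field,finite} poly"
  assumes "degree P \<le> n" "b \<noteq> 0" "eval_fls P (fls_of_T a / fls_of_T b) \<noteq> 0"
  shows "1 \<le> fls_abs (fls_of_T b) ^ n * fls_abs (eval_fls P (fls_of_T a / fls_of_T b))"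
proof -
  let ?x = "fls_of_T a / fls_of_T b"
  have b: "fls_of_T b \<noteq> 0" using assms(2) by (simp add: fls_of_T.hom_eq_0_iff)
  have "eval_fls P ?x = (\<Sum>i\<le>n. fls_of_T (coeff P i) * ?x ^ i)"
    unfolding eval_fls_def poly_altdef using assms(1)
    by (intro sum.mono_neutral_cong_left)
      (auto simp: coeff_map_poly fls_of_T.hom_zero fls_of_T.degree_map_poly_hom coeff_eq_0)
  then have "fls_of_T b ^ n * eval_fls P ?x = (\<Sum>i\<le>n. fls_of_T b ^ n * (fls_of_T (coeff P i) * ?x ^ i))"
    by (simp add: sum_distrib_left)
  also have "\<dots> = (\<Sum>i\<le>n. fls_of_T (coeff P i * a ^ i * b ^ (n - i)))"
    by (intro sum.cong)
      (use b in \<open>simp_all add: fls_of_T.hom_mult fls_of_T.hom_power power_divide power_diff mult_ac\<close>)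
  also have "\<dots> = fls_of_T (\<Sum>i\<le>n. coeff P i * a ^ i * b ^ (n - i))"
    by (simp add: fls_of_T.hom_sum)
  finally have eq: "fls_of_T b ^ n * eval_fls P ?x = fls_of_T (\<Sum>i\<le>n. coeff P i * a ^ i * b ^ (n - i))" .
  then have "(\<Sum>i\<le>n. coeff P i * a ^ i * b ^ (n - i)) \<noteq> 0"
    using assms(3) b by (metis fls_of_T.hom_zero mult_eq_0_iff power_not_zero)
  then have "1 \<le> fls_abs (fls_of_T b ^ n * eval_fls P ?x)"
    unfolding eq by (rule fls_abs_fls_of_T_ge_1)
  then show ?thesis by (simp add: fls.abs_mult fls.abs_power)
qed

section \<open>Degree sequences with prescribed growth\<close>

text \<open>Supplies integers congruent to 1 modulo p in prescribed asymptotic proportions: the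
  numerator differs from B x by at most p.\<close>

lemma floor_div_tendsto:
  fixes x :: real
  assumes "0 < p" "0 \<le> x"
  shows "(\<lambda>B. real (p * nat \<lfloor>real B * x / real p\<rfloor> + 1) / real B) \<longlonglongrightarrow> x"
proof (rule tendsto_sandwich)
  have fl: "real (nat \<lfloor>real B * x / real p\<rfloor>) = of_int \<lfloor>real B * x / real p\<rfloor>" for B
    using assms by simp
  have up: "real p * of_int \<lfloor>real B * x / real p\<rfloor> \<le> real B * x" for B
    using assms mult_left_mono[OF of_int_floor_le[of "real B * x / real p"], of "real p"] by simp
  have lo: "real B * x - real p \<le> real p * of_int \<lfloor>real B * x / real p\<rfloor>" for B
  proof -
    have "real B * x / real p - 1 \<le> of_int \<lfloor>real B * x / real p\<rfloor>" by linarith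
    then have "real p * (real B * x / real p - 1) \<le> real p * of_int \<lfloor>real B * x / real p\<rfloor>"
      by (intro mult_left_mono) auto
    then show ?thesis using assms by (simp add: right_diff_distrib)
  qed
  show "\<forall>\<^sub>F B in sequentially. x - real p / real B \<le> real (p * nat \<lfloor>real B * x / real p\<rfloor> + 1) / real B"
    using eventually_gt_at_top[of 0]
  proof eventually_elim
    case (elim B)
    have "x - real p / real B = (real B * x - real p) / real B"
      using elim by (simp add: diff_divide_distrib)
    also have "\<dots> \<le> real (p * nat \<lfloor>real B * x / real p\<rfloor> + 1) / real B"
      using lo[of B] by (intro divide_right_mono) (auto simp: fl)
    finally show ?case .
  qed
  show "\<forall>\<^sub>F B in sequentially. real (p * nat \<lfloor>real B * x / real p\<rfloor> + 1) / real B \<le> x + 1 / real B"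
    using eventually_gt_at_top[of 0]
  proof eventually_elim
    case (elim B)
    have "real (p * nat \<lfloor>real B * x / real p\<rfloor> + 1) / real B \<le> (real B * x + 1) / real B"
      using up[of B] by (intro divide_right_mono) (auto simp: fl)
    also have "\<dots> = x + 1 / real B" using elim by (simp add: add_divide_distrib)
    finally show ?case .
  qed
  show "(\<lambda>B. x - real p / real B) \<longlonglongrightarrow> x"
    using tendsto_diff[OF tendsto_const lim_const_over_n[of "real p"], of x] by simp
  show "(\<lambda>B. x + 1 / real B) \<longlonglongrightarrow> x"
    using tendsto_add[OF tendsto_const lim_const_over_n[of 1], of x] by simp
qed

text \<open>One period of the degree sequence. Its first ratio is exactly w; the n others are close
  to a common \<mu> with w \<mu>^n = p^k, so that the block closes up at \<open>p ^ k * f 0\<close>.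
  A long block makes \<rho> < \<mu> < w achievable.\<close>

lemma rational_block_exists:
  fixes w \<rho> :: real and p k0 :: nat
  assumes p: "prime p" and w: "w \<in> \<rat>" "1 \<le> \<rho>" "\<rho> < w"
  obtains k n and f :: "nat \<Rightarrow> nat" where "k0 < k" "2 \<le> n" "0 < f 0" "real (f 1) = w * real (f 0)"
    "f (Suc n) = p ^ k * f 0" "\<not> p dvd f n"
    "\<And>i. i \<le> n \<Longrightarrow> \<rho> * real (f i) < real (f (Suc i)) \<and> real (f (Suc i)) \<le> w * real (f i)"
proof -
  have p2: "1 < real p" using prime_gt_1_nat[OF p] by simp
  obtain a b :: nat where ab: "w = real a / real b" "b \<noteq> 0"
    using w by (metis Rats_abs_nat_div_natE abs_of_pos less_trans zero_less_one order.strict_trans1)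
  \<comment> \<open>Consecutive powers of p have quotient p, so one of them lies between w \<rho>^n
    and w^(n+1) as soon as (w/\<rho>)^n > p. The role of \<open>n1\<close> is to push its exponent
    beyond \<open>k0\<close>.\<close>
  obtain n0 where n0: "real p < (w / \<rho>) ^ n0" using real_arch_pow[of "w / \<rho>" "real p"] w by auto
  obtain n1 where n1: "real p ^ Suc k0 < w ^ n1" using real_arch_pow[of w "real p ^ Suc k0"] w by auto
  \<comment> \<open>A length of at least 2 keeps index n apart from 0 and 1, so that
    \<open>f n\<close> is among the entries congruent to 1 modulo p.\<close>
  define n where "n = max 2 (max n0 n1)"
  have n: "2 \<le> n" "n0 \<le> n" "n1 \<le> n" by (auto simp: n_def)
  have pn: "real p < (w / \<rho>) ^ n"
  proof -
    have "1 \<le> w / \<rho>" using w by simp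
    then show ?thesis using n0 power_increasing[OF n(2)] by (rule_tac less_le_trans)
  qed
  have kn: "real p ^ Suc k0 < w ^ Suc n"
    using n1 power_increasing[of n1 "Suc n" w] n w by auto
  \<comment> \<open>\<open>p ^ k\<close> is the largest power of \<open>p\<close> below \<open>w ^ (n + 1)\<close>, so \<open>w \<rho>\<^sup>n < p ^ k < w ^ (n + 1)\<close>.\<close>
  obtain N where N: "w ^ Suc n < real p ^ N" using real_arch_pow[OF p2] by blast
  define k where "k = Max {k. real p ^ k < w ^ Suc n}"
  have fin: "finite {k. real p ^ k < w ^ Suc n}"
  proof (rule finite_subset)
    show "{k. real p ^ k < w ^ Suc n} \<subseteq> {..N}"
    proof
      fix k assume "k \<in> {k. real p ^ k < w ^ Suc n}"
      then have "real p ^ k < real p ^ N" using N by simp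
      then show "k \<in> {..N}" using p2 by simp
    qed
  qed simp
  have k: "real p ^ k < w ^ Suc n"
  proof -
    have "Suc k0 \<in> {k. real p ^ k < w ^ Suc n}" using kn by blast
    then have "{k. real p ^ k < w ^ Suc n} \<noteq> {}" by blast
    from Max_in[OF fin this] show ?thesis unfolding k_def by blast
  qed
  have "Suc k0 \<le> k" unfolding k_def using fin kn by (intro Max_ge CollectI)
  have k': "w ^ Suc n \<le> real p ^ Suc k"
    using Max_ge[OF fin, of "Suc k"] unfolding k_def[symmetric] by force
  have lower: "w * \<rho> ^ n < real p ^ k"
  proof -
    have "real p * (w * \<rho> ^ n) < (w / \<rho>) ^ n * (w * \<rho> ^ n)"
      using pn w by (intro mult_strict_right_mono) auto
    also have "\<dots> = w ^ Suc n" using w by (simp add: power_divide)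
    also have "\<dots> \<le> real p * real p ^ k" using k' by simp
    finally show ?thesis using p2 by simp
  qed
  define \<mu> where "\<mu> = root n (real p ^ k / w)"
  have "0 < n" using n by simp
  have \<mu>n: "\<mu> ^ n = real p ^ k / w" using \<open>0 < n\<close> w by (simp add: \<mu>_def)
  have \<mu>0: "0 < \<mu>" using \<open>0 < n\<close> w p2 by (simp add: \<mu>_def)
  have \<mu>1: "\<rho> < \<mu>"
  proof (rule power_less_imp_less_base)
    show "\<rho> ^ n < \<mu> ^ n" using lower w by (simp add: \<mu>n field_simps)
  qed (use \<mu>0 in simp)
  have \<mu>2: "\<mu> < w"
  proof (rule power_less_imp_less_base)
    show "\<mu> ^ n < w ^ n" using k w by (simp add: \<mu>n field_simps)
  qed (use w in simp)
  \<comment> \<open>The ideal proportions. The block itself is their integer approximation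
    \<open>F B\<close> at scale \<open>B\<close>: exact at the indices 0, 1 and n + 1, congruent to
    1 modulo p in between.\<close>
  define t where "t i = (if i = 0 then real b else real b * w * \<mu> ^ (i - 1))" for i
  have t: "0 \<le> t i" for i using w \<mu>0 by (simp add: t_def)
  define F where "F B i = (if i = 0 then b * B else if i = 1 then a * B
      else if i \<le> n then p * nat \<lfloor>real B * t i / real p\<rfloor> + 1 else p ^ k * b * B)" for B i
  have lim: "(\<lambda>B. real (F B i) / real B) \<longlonglongrightarrow> t i" if i: "i \<le> Suc n" for i
  proof -
    have const: "(\<lambda>B. real (c * B) / real B) \<longlonglongrightarrow> real c" for c
    proof (rule tendsto_eventually)
      show "\<forall>\<^sub>F B in sequentially. real (c * B) / real B = real c"
        using eventually_gt_at_top[of 0] by eventually_elim simp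
    qed
    consider "i = 0" | "i = 1" | "2 \<le> i" "i \<le> n" | "i = Suc n" "2 \<le> i" using i n by linarith
    then show ?thesis
    proof cases
      case 1
      then show ?thesis using const[of b] by (simp add: F_def t_def)
    next
      case 2
      then show ?thesis using const[of a] ab by (simp add: F_def t_def)
    next
      case 3
      then show ?thesis using floor_div_tendsto[of p "t i"] t p2 by (simp add: F_def)
    next
      case 4
      then show ?thesis using const[of "p ^ k * b"] \<mu>n w by (simp add: F_def t_def mult.commute)
    qed
  qed
  have tt: "\<rho> * t i < t (Suc i)" "0 < i \<Longrightarrow> t (Suc i) < w * t i" for i
  proof -
    have tp: "0 < t i" using w(2,3) ab(2) \<mu>0 by (simp add: t_def)
    show "0 < i \<Longrightarrow> t (Suc i) < w * t i"
    proof -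
      assume "0 < i"
      then have "t (Suc i) = \<mu> * t i" by (cases i) (auto simp: t_def)
      then show ?thesis using \<mu>2 tp by simp
    qed
    show "\<rho> * t i < t (Suc i)"
    proof (cases i)
      case 0
      then show ?thesis using w(3) ab(2) by (simp add: t_def mult.commute)
    next
      case (Suc j)
      then have "t (Suc i) = \<mu> * t i" by (auto simp: t_def)
      then show ?thesis using \<mu>1 tp by simp
    qed
  qed
  have "\<forall>\<^sub>F B in sequentially. \<rho> * (real (F B i) / real B) < real (F B (Suc i)) / real B" if "i \<le> n" for i
  proof -
    have "(\<lambda>B. real (F B (Suc i)) / real B - \<rho> * (real (F B i) / real B)) \<longlonglongrightarrow> t (Suc i) - \<rho> * t i"
      using that by (intro tendsto_intros lim) auto
    from order_tendstoD(1)[OF this, of 0] show ?thesis using tt(1)[of i] by simp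
  qed
  moreover have "\<forall>\<^sub>F B in sequentially. 0 < i \<longrightarrow> real (F B (Suc i)) / real B < w * (real (F B i) / real B)" if "i \<le> n" for i
  proof (cases "0 < i")
    case True
    have "(\<lambda>B. w * (real (F B i) / real B) - real (F B (Suc i)) / real B) \<longlonglongrightarrow> w * t i - t (Suc i)"
      using that by (intro tendsto_intros lim) auto
    from order_tendstoD(1)[OF this, of 0] show ?thesis using tt(2)[OF True] True by simp
  qed auto
  \<comment> \<open>Finitely many strict inequalities between the limits hold for large
    \<open>B\<close>. The bound by w is left out at i = 0, where it is an equality that
    \<open>F\<close> satisfies exactly.\<close>
  ultimately have "\<forall>\<^sub>F B in sequentially. 0 < B \<and> (\<forall>i\<in>{..n}. \<rho> * (real (F B i) / real B) < real (F B (Suc i)) / real B \<and>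
      (0 < i \<longrightarrow> real (F B (Suc i)) / real B < w * (real (F B i) / real B)))"
    by (intro eventually_conj eventually_gt_at_top eventually_ball_finite ballI) auto
  then obtain B where B: "0 < B" and FB: "\<And>i. i \<le> n \<Longrightarrow> \<rho> * (real (F B i) / real B) < real (F B (Suc i)) / real B"
      "\<And>i. i \<le> n \<Longrightarrow> 0 < i \<Longrightarrow> real (F B (Suc i)) / real B < w * (real (F B i) / real B)"
    using eventually_happens'[OF sequentially_bot] by (metis (no_types, lifting) atMost_iff)
  have F0: "0 < F B 0" "real (F B 1) = w * real (F B 0)" using B ab by (auto simp: F_def)
  show ?thesis
  proof (rule that[of k n "F B"])
    show "F B (Suc n) = p ^ k * F B 0" using n by (simp add: F_def)
    show "\<not> p dvd F B n"
    proof
      assume "p dvd F B n"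
      then have "p dvd p * nat \<lfloor>real B * t n / real p\<rfloor> + 1" using n by (simp add: F_def)
      then have "p dvd 1" by (metis dvd_add_right_iff dvd_triv_left)
      then show False using p2 by simp
    qed
    fix i assume i: "i \<le> n"
    have "\<rho> * real (F B i) < real (F B (Suc i))" using FB(1)[OF i] B by (simp add: field_simps)
    moreover have "real (F B (Suc i)) \<le> w * real (F B i)"
      using FB(2)[OF i] B F0(2) by (cases "i = 0") (simp_all add: field_simps)
    ultimately show "\<rho> * real (F B i) < real (F B (Suc i)) \<and> real (F B (Suc i)) \<le> w * real (F B i)" by simp
  qed (use F0 n \<open>Suc k0 \<le> k\<close> in auto)
qed

text \<open>The block is repeated with a factor p^k per period. It ends at p^k times its start, so
  the ratio across a seam is one of the ratios of the block. The last conclusion is the ratio bound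
  w(d-1)/(w-d) without its denominator.\<close>

lemma degree_sequence_exists:
  fixes w :: real and p d k0 :: nat
  assumes p: "prime p" and w: "w \<in> \<rat>" "1 \<le> d" "2 * real d - 1 < w"
  obtains k l and Y :: "nat \<Rightarrow> nat" where "k0 < k" "0 < l" "strict_mono Y"
    "\<And>n. Y (n + l) = p ^ k * Y n" "\<not> p dvd Y (l - 1)"
    "\<And>n. real (Y (Suc n)) \<le> w * real (Y n)" "\<And>j. real (Y (Suc (j * l))) = w * real (Y (j * l))"
    "\<And>n. real d * real (Y (Suc n)) \<le> w * (real (Y (Suc n)) - (real d - 1) * real (Y n))"
proof -
  have wd: "real d < w" "0 < w" using w by auto
  \<comment> \<open>The 1 gives strict monotonicity; the other bound is below w because d - 1 < w -
    d.\<close>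
  define \<rho> where "\<rho> = max 1 (w * (real d - 1) / (w - real d))"
  have "w * (real d - 1) < w * (w - real d)" using w wd by (intro mult_strict_left_mono) auto
  then have "\<rho> < w" using w wd by (simp add: \<rho>_def field_simps)
  moreover have "1 \<le> \<rho>" by (simp add: \<rho>_def)
  ultimately obtain k n and f :: "nat \<Rightarrow> nat" where kn: "k0 < k" "2 \<le> n" and f: "0 < f 0"
    "real (f 1) = w * real (f 0)" "f (Suc n) = p ^ k * f 0" "\<not> p dvd f n"
    "\<And>i. i \<le> n \<Longrightarrow> \<rho> * real (f i) < real (f (Suc i)) \<and> real (f (Suc i)) \<le> w * real (f i)"
    using rational_block_exists[OF p w(1)] by metis
  define l where "l = Suc n"
  define Y where "Y m = (p ^ k) ^ (m div l) * f (m mod l)" for m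
  have "0 < p" using p prime_gt_0_nat by blast
  have "0 < l" by (simp add: l_def)
  have succ: "\<exists>c>0. \<exists>i\<le>n. i = m mod l \<and> Y m = c * f i \<and> Y (Suc m) = c * f (Suc i)" for m
  proof -
    have i: "m mod l \<le> n" using mod_less_divisor[of l m] by (simp add: l_def)
    have "Y (Suc m) = (p ^ k) ^ (m div l) * f (Suc (m mod l))"
    proof (cases "Suc (m mod l) = l")
      case True
      then have "Suc m mod l = 0" "Suc m div l = Suc (m div l)" by (auto simp: mod_Suc div_Suc)
      moreover have "f (Suc (m mod l)) = p ^ k * f 0" using True f(3) by (simp add: l_def)
      ultimately show ?thesis by (simp add: Y_def mult_ac)
    next
      case False
      then have "Suc m mod l = Suc (m mod l)" "Suc m div l = m div l" by (auto simp: mod_Suc div_Suc)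
      then show ?thesis by (simp add: Y_def)
    qed
    moreover have "0 < (p ^ k) ^ (m div l)" using \<open>0 < p\<close> by simp
    ultimately show ?thesis using i Y_def[of m] by blast
  qed
  have ratio: "\<rho> * real (Y m) < real (Y (Suc m)) \<and> real (Y (Suc m)) \<le> w * real (Y m)" for m
  proof -
    obtain c i where "0 < c" "i \<le> n" "Y m = c * f i" "Y (Suc m) = c * f (Suc i)" using succ[of m] by blast
    then show ?thesis using f(5)[of i] by simp
  qed
  show ?thesis
  proof (rule that[of k l Y])
    show "strict_mono Y"
    proof (rule strict_mono_Suc_iff[THEN iffD2], intro allI)
      fix m
      have "1 * real (Y m) \<le> \<rho> * real (Y m)" using \<open>1 \<le> \<rho>\<close> by (intro mult_right_mono) auto
      then show "Y m < Y (Suc m)" using ratio[of m] by simp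
    qed
    show "Y (m + l) = p ^ k * Y m" for m by (simp add: Y_def div_add_self2 mult.assoc \<open>0 < l\<close>)
    show "\<not> p dvd Y (l - 1)" using f(4) by (simp add: Y_def l_def)
    show "real (Y (Suc m)) \<le> w * real (Y m)" for m using ratio by blast
    show "real (Y (Suc (j * l))) = w * real (Y (j * l))" for j
    proof -
      obtain c where "Y (j * l) = c * f 0" "Y (Suc (j * l)) = c * f (Suc 0)" using succ[of "j * l"] by auto
      then show ?thesis using f(2) by simp
    qed
    show "real d * real (Y (Suc m)) \<le> w * (real (Y (Suc m)) - (real d - 1) * real (Y m))" for m
    proof -
      have "w * (real d - 1) / (w - real d) * real (Y m) \<le> \<rho> * real (Y m)"
        by (intro mult_right_mono) (auto simp: \<rho>_def)
      then have "w * (real d - 1) / (w - real d) * real (Y m) \<le> real (Y (Suc m))" using ratio[of m] by simp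
      then have "w * (real d - 1) * real (Y m) \<le> real (Y (Suc m)) * (w - real d)"
        using wd by (simp add: field_simps)
      then show ?thesis by (simp add: algebra_simps)
    qed
  qed (use kn f in \<open>auto simp: l_def Y_def\<close>)
qed

section \<open>Continued fractions fixed by a power of Frobenius\<close>

text \<open>The initial values are left free, to be chosen so that the convergent \<open>c n\<close>
  formed below is [0; a_0, ..., a_(n-1)], with \<open>c 0\<close> equal to 0.\<close>

fun continuant :: "(nat \<Rightarrow> 'a::comm_ring_1) \<Rightarrow> 'a \<Rightarrow> 'a \<Rightarrow> nat \<Rightarrow> 'a" where
  "continuant a u v 0 = u"
| "continuant a u v (Suc 0) = v"
| "continuant a u v (Suc (Suc n)) = a (Suc n) * continuant a u v (Suc n) + continuant a u v n"

locale frobenius_continued_fraction =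
  fixes p k l :: nat and Y :: "nat \<Rightarrow> nat" and a :: "nat \<Rightarrow> 'a::{field,finite} poly"
  assumes a_def: "a n = Polynomial.monom 1 (Y (Suc n) - Y n)"
    and p: "prime p" and CHAR: "CHAR('a) = p" and l: "0 < l"
    and Y_mono: "strict_mono Y" and Y_shift: "Y (n + l) = p ^ k * Y n"
begin

definition r :: nat where "r = p ^ k"
definition P :: "nat \<Rightarrow> 'a poly" where "P = continuant a 0 1"
definition Q :: "nat \<Rightarrow> 'a poly" where "Q = continuant a 1 (a 0)"
definition c :: "nat \<Rightarrow> 'a fls" where "c n = fls_of_T (P n) / fls_of_T (Q n)"
definition \<xi> :: "'a fls" where "\<xi> = (SOME \<xi>. \<forall>n. fls_abs (\<xi> - c n) \<le> real CARD('a) powi (- int n))"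

lemma P_simps: "P 0 = 0" "P (Suc 0) = 1" "P (Suc (Suc n)) = a (Suc n) * P (Suc n) + P n"
  by (simp_all add: P_def)

lemma Q_simps: "Q 0 = 1" "Q (Suc 0) = a 0" "Q (Suc (Suc n)) = a (Suc n) * Q (Suc n) + Q n"
  by (simp_all add: Q_def)

lemma q_gt_1: "1 < real CARD('a)"
  by (rule CARD_gt_1)

lemma r_pos: "0 < r"
  using prime_gt_0_nat[OF p] by (simp add: r_def)

lemma Y_Suc: "Y n < Y (Suc n)"
  using Y_mono by (simp add: strict_mono_Suc_iff)

lemma Y_ge_Y0: "Y 0 \<le> Y n"
  using Y_mono strict_mono_less_eq by blast

lemma Y_ge: "Y 0 + n \<le> Y n"
proof (induction n)
  case (Suc n)
  then show ?case using Y_Suc[of n] by simp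
qed simp

lemma degree_a: "degree (a n) = Y (Suc n) - Y n" and lead_coeff_a: "lead_coeff (a n) = 1"
  by (simp_all add: a_def degree_monom_eq)

lemma a_nonzero: "a n \<noteq> 0"
  by (simp add: a_def)

text \<open>The degrees of the partial quotients telescope. Monicity of \<open>Q n\<close> makes Q_n
  X - P_n meet the normalisation in \<open>min_poly_T\<close>.\<close>

lemma degree_lead_coeff_Q: "degree (Q n) = Y n - Y 0 \<and> lead_coeff (Q n) = 1"
proof (induction n rule: induct_nat_012)
  case (ge2 n)
  have nz: "Q (Suc n) \<noteq> 0" using ge2 by auto
  have "degree (a (Suc n) * Q (Suc n)) = Y (Suc (Suc n)) - Y 0"
    using ge2 nz a_nonzero Y_Suc[of "Suc n"] Y_ge_Y0[of "Suc n"] by (simp add: degree_mult_eq degree_a)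
  moreover have "degree (Q n) < Y (Suc (Suc n)) - Y 0"
    using ge2 Y_Suc[of n] Y_Suc[of "Suc n"] Y_ge_Y0[of n] by simp
  ultimately have "degree (Q (Suc (Suc n))) = Y (Suc (Suc n)) - Y 0"
    "lead_coeff (Q (Suc (Suc n))) = lead_coeff (a (Suc n) * Q (Suc n))"
    using degree_add_eq_left[of "Q n" "a (Suc n) * Q (Suc n)"]
      lead_coeff_add_le[of "Q n" "a (Suc n) * Q (Suc n)"]
    by (simp_all add: Q_simps add.commute)
  then show ?case using ge2(2) by (metis lead_coeff_mult lead_coeff_a mult_1)
next
  case 1
  then show ?case using lead_coeff_a[of 0] by (simp add: Q_simps degree_a)
qed (simp add: Q_simps)

lemma Q_nonzero: "Q n \<noteq> 0"
  using degree_lead_coeff_Q[of n] by auto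

lemma abs_Q: "fls_abs (fls_of_T (Q n)) = real CARD('a) ^ (Y n - Y 0)"
  by (simp add: fls_abs_fls_of_T Q_nonzero degree_lead_coeff_Q)

lemma abs_Q_pos: "0 < fls_abs (fls_of_T (Q n))"
  using q_gt_1 by (simp add: abs_Q)

lemma abs_Q_less: "fls_abs (fls_of_T (Q n)) < fls_abs (fls_of_T (Q (Suc n)))"
  unfolding abs_Q using q_gt_1 Y_Suc[of n] Y_ge_Y0[of n] by (intro power_strict_increasing) auto

lemma abs_P_less_Q: "fls_abs (fls_of_T (P n)) < fls_abs (fls_of_T (Q n))"
proof (induction n rule: induct_nat_012)
  case 0
  then show ?case by (simp add: P_simps Q_simps fls_of_T.hom_zero fls.abs_zero fls_of_T.hom_one fls.abs_one)
next
  case 1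
  then show ?case using abs_Q_less[of 0] by (simp add: P_simps Q_simps fls_of_T.hom_one)
next
  case (ge2 n)
  have nz: "0 < fls_abs (fls_of_T (a (Suc n)))"
    using a_nonzero by (simp add: fls.abs_pos_iff fls_of_T.hom_eq_0_iff)
  have "real CARD('a) ^ (Y (Suc (Suc n)) - Y 0) = real CARD('a) ^ (Y (Suc (Suc n)) - Y (Suc n)) * real CARD('a) ^ (Y (Suc n) - Y 0)"
    using Y_Suc[of "Suc n"] Y_ge_Y0[of "Suc n"] by (simp flip: power_add)
  then have QQ: "fls_abs (fls_of_T (Q (Suc (Suc n)))) =
      fls_abs (fls_of_T (a (Suc n))) * fls_abs (fls_of_T (Q (Suc n)))"
    by (simp add: abs_Q fls_abs_fls_of_T a_nonzero degree_a)
  have "fls_abs (fls_of_T (a (Suc n) * P (Suc n))) < fls_abs (fls_of_T (Q (Suc (Suc n))))"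
    unfolding QQ fls_of_T.hom_mult fls.abs_mult using ge2(2) nz by (rule mult_strict_left_mono)
  moreover have "fls_abs (fls_of_T (P n)) < fls_abs (fls_of_T (Q (Suc (Suc n))))"
    using ge2(1) abs_Q_less[of n] abs_Q_less[of "Suc n"] by linarith
  ultimately show ?case
    using fls.abs_add_le[of "fls_of_T (a (Suc n) * P (Suc n))" "fls_of_T (P n)"]
    by (simp add: P_simps fls_of_T.hom_add)
qed

section \<open>Distances between the convergents and their limit\<close>

lemma det: "P (Suc n) * Q n - P n * Q (Suc n) = (- 1) ^ n"
proof (induction n)
  case (Suc n)
  have "P (Suc (Suc n)) * Q (Suc n) - P (Suc n) * Q (Suc (Suc n))
      = - (P (Suc n) * Q n - P n * Q (Suc n))"
    by (simp add: P_simps Q_simps algebra_simps)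
  then show ?case by (simp only: Suc) simp
qed (simp add: P_simps Q_simps)

lemma abs_c_less_1: "fls_abs (c n) < 1"
  using abs_P_less_Q[of n] abs_Q_pos[of n] by (simp add: c_def fls.abs_divide)

text \<open>The distance between consecutive convergents, which turns out in
  \<open>abs_\<xi>_diff\<close> to be the exact distance from \<xi>.\<close>

definition \<delta> :: "nat \<Rightarrow> real" where
  "\<delta> n = 1 / (fls_abs (fls_of_T (Q n)) * fls_abs (fls_of_T (Q (Suc n))))"

lemma \<delta>_pos: "0 < \<delta> n"
  using abs_Q_pos by (simp add: \<delta>_def)

lemma \<delta>_Suc_less: "\<delta> (Suc n) < \<delta> n"
proof -
  have "fls_abs (fls_of_T (Q n)) < fls_abs (fls_of_T (Q (Suc (Suc n))))"
    using abs_Q_less[of n] abs_Q_less[of "Suc n"] by linarith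
  then show ?thesis using abs_Q_pos by (simp add: \<delta>_def divide_strict_left_mono)
qed

lemma \<delta>_le: "\<delta> n \<le> real CARD('a) powi (- int n)"
proof -
  have "real CARD('a) ^ n \<le> real CARD('a) ^ (Y (Suc n) - Y 0)"
    using q_gt_1 Y_ge[of "Suc n"] by (intro power_increasing) auto
  also have "1 * real CARD('a) ^ (Y (Suc n) - Y 0) \<le> real CARD('a) ^ (Y n - Y 0) * real CARD('a) ^ (Y (Suc n) - Y 0)"
    using q_gt_1 by (intro mult_right_mono) auto
  finally have "1 / (real CARD('a) ^ (Y n - Y 0) * real CARD('a) ^ (Y (Suc n) - Y 0)) \<le> 1 / real CARD('a) ^ n"
    using q_gt_1 by (intro divide_left_mono) auto
  then show ?thesis by (simp add: \<delta>_def abs_Q power_int_minus divide_inverse)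
qed

lemma abs_c_diff: "fls_abs (c (Suc n) - c n) = \<delta> n"
proof -
  have "fls_of_T (Q n) \<noteq> 0" "fls_of_T (Q (Suc n)) \<noteq> 0" using Q_nonzero by (auto simp: fls_of_T.hom_eq_0_iff)
  then have "c (Suc n) - c n = fls_of_T (P (Suc n) * Q n - P n * Q (Suc n)) / (fls_of_T (Q n) * fls_of_T (Q (Suc n)))"
    by (simp add: c_def fls_of_T.hom_diff fls_of_T.hom_mult field_simps)
  then show ?thesis
    by (simp add: det fls_of_T.hom_power fls_of_T.hom_uminus fls_of_T.hom_one fls.abs_divide
        fls.abs_power fls.abs_uminus fls.abs_one fls.abs_mult \<delta>_def)
qed

lemma abs_\<xi>_diff_le: "fls_abs (\<xi> - c n) \<le> real CARD('a) powi (- int n)"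
proof -
  have "\<exists>\<xi>. \<forall>n. fls_abs (\<xi> - c n) \<le> real CARD('a) powi (- int n)"
    using fls_abs_limit[of c] abs_c_diff \<delta>_le by metis
  then have "\<forall>n. fls_abs (\<xi> - c n) \<le> real CARD('a) powi (- int n)"
    unfolding \<xi>_def by (rule someI_ex)
  then show ?thesis by blast
qed

lemma \<delta>_less: "n < m \<Longrightarrow> \<delta> m < \<delta> n"
  using lift_Suc_mono_less[of "\<lambda>n. - \<delta> n" n m] \<delta>_Suc_less by simp

text \<open>Consecutive distances strictly decrease, so the first step of the telescoping sum
  dominates.\<close>

lemma abs_c_diff_later: "n < m \<Longrightarrow> fls_abs (c m - c n) = \<delta> n"
proof (induction m)
  case (Suc m)
  show ?case
  proof (cases "m = n")
    case False
    then have "fls_abs (c (Suc m) - c m) < fls_abs (c m - c n)"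
      using Suc abs_c_diff[of m] \<delta>_less[of n m] by simp
    from fls.abs_add_eq[OF this] show ?thesis using Suc False by simp
  qed (simp add: abs_c_diff)
qed simp

lemma abs_\<xi>_diff: "fls_abs (\<xi> - c n) = \<delta> n"
proof -
  obtain m where m: "1 / \<delta> n < real CARD('a) ^ m" using real_arch_pow[OF q_gt_1] by blast
  define N where "N = max m (Suc n)"
  have "real CARD('a) powi (- int N) \<le> real CARD('a) powi (- int m)" using q_gt_1 by (intro power_int_increasing) (auto simp: N_def)
  also have "\<dots> < \<delta> n" using m \<delta>_pos[of n] q_gt_1 by (simp add: power_int_minus field_simps)
  finally have "fls_abs (\<xi> - c N) < fls_abs (c N - c n)"
    using abs_\<xi>_diff_le[of N] abs_c_diff_later[of n N] by (simp add: N_def)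
  from fls.abs_add_eq[OF this] show ?thesis using abs_c_diff_later[of n N] by (simp add: N_def)
qed

lemma abs_\<xi>_less_1: "fls_abs \<xi> < 1"
proof -
  have "c 0 = 0" by (simp add: c_def P_simps fls_of_T.hom_zero)
  then show ?thesis
    using abs_\<xi>_diff[of 0] abs_Q_less[of 0] by (simp add: \<delta>_def Q_simps fls_of_T.hom_one fls.abs_one)
qed

section \<open>Frobenius and the self-similarity of the continued fraction\<close>

lemma CHAR_power_add:
  fixes x y :: "'b::comm_semiring_1"
  assumes "CHAR('b) = p"
  shows "(x + y) ^ r = x ^ r + y ^ r"
  using freshmans_dream'[where 'a = 'b, of r k x y] p assms by (simp add: r_def)

lemma a_shift: "a (n + l) = a n ^ r"
  using Y_shift[of n] Y_shift[of "Suc n"]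
  by (simp add: a_def monom_power r_def diff_mult_distrib2 mult.commute)

text \<open>As \<open>a (n + l) = a n ^ r\<close> and r-th powers are additive, the r-th powers of
  \<open>P\<close> and \<open>Q\<close> satisfy the recurrence of the shifted sequence. A solution
  is determined by two consecutive members, which fixes the coefficients \<open>Z l\<close> and
  \<open>Z (l - 1)\<close>.\<close>

lemma continuant_shift:
  assumes Z: "\<And>n. Z (Suc (Suc n)) = a (Suc n) * Z (Suc n) + Z n"
  shows "Z (n + l) = Z l * Q n ^ r + Z (l - 1) * P n ^ r"
proof (induction n rule: induct_nat_012)
  case 0
  then show ?case using r_pos by (simp add: P_simps Q_simps)
next
  case 1
  obtain l' where "l = Suc l'" using l by (cases l) auto
  then show ?case using Z[of l'] a_shift[of 0] by (simp add: P_simps Q_simps mult.commute)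
next
  case (ge2 n)
  have "Z (Suc (Suc n) + l) = a (Suc n + l) * Z (Suc n + l) + Z (n + l)"
    using Z[of "n + l"] by simp
  then show ?case
    unfolding ge2 a_shift P_simps(3)[of n] Q_simps(3)[of n]
    using CHAR by (simp add: CHAR_power_add power_mult_distrib algebra_simps)
qed

lemma c_shift:
  "c (n + l) * (fls_of_T (Q (l - 1)) * c n ^ r + fls_of_T (Q l))
    = fls_of_T (P (l - 1)) * c n ^ r + fls_of_T (P l)"
proof -
  have nz: "fls_of_T (Q m) \<noteq> 0" for m using Q_nonzero by (simp add: fls_of_T.hom_eq_0_iff)
  have "fls_of_T (Q (l - 1)) * c n ^ r + fls_of_T (Q l)
      = fls_of_T (Q l * Q n ^ r + Q (l - 1) * P n ^ r) / fls_of_T (Q n) ^ r"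
    using nz[of n] by (simp add: c_def fls_of_T.hom_add fls_of_T.hom_mult fls_of_T.hom_power power_divide field_simps)
  then have 1: "fls_of_T (Q (l - 1)) * c n ^ r + fls_of_T (Q l) = fls_of_T (Q (n + l)) / fls_of_T (Q n) ^ r"
    using continuant_shift[of Q n] by (simp add: Q_simps)
  have "fls_of_T (P (l - 1)) * c n ^ r + fls_of_T (P l)
      = fls_of_T (P l * Q n ^ r + P (l - 1) * P n ^ r) / fls_of_T (Q n) ^ r"
    using nz[of n] by (simp add: c_def fls_of_T.hom_add fls_of_T.hom_mult fls_of_T.hom_power power_divide field_simps)
  then have 2: "fls_of_T (P (l - 1)) * c n ^ r + fls_of_T (P l) = fls_of_T (P (n + l)) / fls_of_T (Q n) ^ r"
    using continuant_shift[of P n] by (simp add: P_simps)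
  show ?thesis unfolding 1 2 using nz[of "n + l"] by (simp add: c_def)
qed

text \<open>The limit of \<open>c_shift\<close>. Subtracting from \<open>E\<close> the same
  expression at the convergents, which is 0, leaves a combination of two small errors with
  coefficients bounded by \<open>K\<close>.\<close>

lemma \<xi>_equation:
  "\<xi> * (fls_of_T (Q (l - 1)) * \<xi> ^ r + fls_of_T (Q l)) = fls_of_T (P (l - 1)) * \<xi> ^ r + fls_of_T (P l)"
proof -
  define V U R S where "V = fls_of_T (Q (l - 1))" and "U = fls_of_T (Q l)"
    and "R = fls_of_T (P (l - 1))" and "S = fls_of_T (P l)"
  define E where "E = \<xi> * (V * \<xi> ^ r + U) - (R * \<xi> ^ r + S)"
  define K where "K = max (fls_abs (V * \<xi> ^ r + U)) (max (fls_abs V) (fls_abs R))"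
  have K: "0 \<le> K" by (simp add: K_def fls.abs_nonneg le_max_iff_disj)
  have bound: "fls_abs E \<le> K * real CARD('a) powi (- int n)" for n
  proof -
    define \<eta> where "\<eta> = \<xi> ^ r - c n ^ r"
    have "fls_abs (poly (Polynomial.monom 1 r) \<xi> - poly (Polynomial.monom 1 r) (c n)) \<le> 1 * fls_abs (\<xi> - c n)"
      by (rule fls.abs_poly_diff_le)
        (use abs_\<xi>_less_1 abs_c_less_1[of n] in \<open>auto simp: fls.abs_one fls.abs_zero\<close>)
    then have \<eta>: "fls_abs \<eta> \<le> real CARD('a) powi (- int n)"
      using abs_\<xi>_diff_le[of n] by (simp add: \<eta>_def poly_monom)
    have "real CARD('a) powi (- int (n + l)) \<le> real CARD('a) powi (- int n)" using q_gt_1 by (intro power_int_increasing) auto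
    then have \<epsilon>: "fls_abs (\<xi> - c (n + l)) \<le> real CARD('a) powi (- int n)" using abs_\<xi>_diff_le[of "n + l"] by linarith
    have "E = E - (c (n + l) * (V * c n ^ r + U) - (R * c n ^ r + S))"
      using c_shift[of n] by (simp add: V_def U_def R_def S_def)
    also have "\<dots> = (\<xi> - c (n + l)) * (V * \<xi> ^ r + U) + (c (n + l) * V * \<eta> - R * \<eta>)"
      by (simp add: E_def \<eta>_def algebra_simps)
    finally have "E = (\<xi> - c (n + l)) * (V * \<xi> ^ r + U) + (c (n + l) * V * \<eta> - R * \<eta>)" .
    moreover have "fls_abs ((\<xi> - c (n + l)) * (V * \<xi> ^ r + U)) \<le> real CARD('a) powi (- int n) * K"
      unfolding fls.abs_mult using \<epsilon> q_gt_1 by (intro mult_mono) (auto simp: K_def fls.abs_nonneg)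
    moreover have "fls_abs (c (n + l) * V * \<eta>) \<le> 1 * K * real CARD('a) powi (- int n)"
      unfolding fls.abs_mult using \<eta> abs_c_less_1[of "n + l"] K q_gt_1
      by (intro mult_mono mult_nonneg_nonneg) (auto simp: K_def fls.abs_nonneg)
    moreover have "fls_abs (R * \<eta>) \<le> K * real CARD('a) powi (- int n)"
      unfolding fls.abs_mult using \<eta> K q_gt_1
      by (intro mult_mono) (auto simp: K_def fls.abs_nonneg)
    ultimately show ?thesis
      using fls.abs_add_le[of "(\<xi> - c (n + l)) * (V * \<xi> ^ r + U)" "c (n + l) * V * \<eta> - R * \<eta>"]
        fls.abs_diff_le[of "c (n + l) * V * \<eta>" "R * \<eta>"] by (simp add: mult.commute)
  qed
  have "E = 0"
  proof (rule ccontr)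
    assume "E \<noteq> 0"
    then have E: "0 < fls_abs E" by (simp add: fls.abs_pos_iff)
    obtain n where "K / fls_abs E < real CARD('a) ^ n" using real_arch_pow[OF q_gt_1] by blast
    then have "K * real CARD('a) powi (- int n) < fls_abs E" using E q_gt_1 by (simp add: power_int_minus field_simps)
    then show False using bound[of n] by simp
  qed
  then show ?thesis by (simp add: E_def V_def U_def R_def S_def)
qed

lemma abs_denominator: "fls_abs (fls_of_T (Q (l - 1)) * \<xi> ^ r + fls_of_T (Q l)) = fls_abs (fls_of_T (Q l))"
proof (rule fls.abs_add_eq)
  have "fls_abs (fls_of_T (Q (l - 1)) * \<xi> ^ r) \<le> fls_abs (fls_of_T (Q (l - 1))) * 1"
    unfolding fls.abs_mult fls.abs_power using abs_\<xi>_less_1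
    by (intro mult_left_mono power_le_one) (auto simp: fls.abs_nonneg)
  also have "\<dots> < fls_abs (fls_of_T (Q l))" using abs_Q_less[of "l - 1"] l by simp
  finally show "fls_abs (fls_of_T (Q (l - 1)) * \<xi> ^ r) < fls_abs (fls_of_T (Q l))" .
qed

lemma class_IA_\<xi>:
  assumes "\<xi> \<notin> rat_funs"
  shows "class_IA p \<xi>"
  unfolding class_IA_def
proof (intro conjI exI)
  have "P l * Q (l - 1) - P (l - 1) * Q l = (- 1) ^ (l - 1)" using det[of "l - 1"] l by simp
  then have "P (l - 1) * Q l - P l * Q (l - 1) = - ((- 1) ^ (l - 1))" by (metis minus_diff_eq)
  also have "\<dots> = [:- ((- 1) ^ (l - 1)):]"
    unfolding minus_one_power_iff by (simp add: one_pCons)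
  finally show "P (l - 1) * Q l - P l * Q (l - 1) = [:- ((- 1) ^ (l - 1)):]" .
  have "fls_of_T (Q (l - 1)) * \<xi> ^ p ^ k + fls_of_T (Q l) \<noteq> 0"
    using abs_denominator abs_Q_pos[of l] fls.abs_pos_iff by (metis r_def)
  then show "\<xi> = (fls_of_T (P (l - 1)) * \<xi> ^ p ^ k + fls_of_T (P l)) / (fls_of_T (Q (l - 1)) * \<xi> ^ p ^ k + fls_of_T (Q l))"
    using \<xi>_equation unfolding r_def by (simp add: eq_divide_eq)
qed (use assms in auto)

end

section \<open>Diophantine exponents\<close>

lemma eval_fls_mult: "eval_fls (F * G) x = eval_fls F x * eval_fls G x"
  by (simp add: eval_fls_def fls_of_T.map_poly_hom_mult)

lemma eval_fls_linear: "eval_fls [:- a, b:] x = fls_of_T b * x - fls_of_T a"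
  by (simp add: eval_fls_def map_poly_pCons fls_of_T.hom_zero fls_of_T.hom_uminus mult.commute)

text \<open>A lower bound of order H^(-w) meets an upper bound of order H^(-w') and bounds H.
  Finiteness of bounded height then limits the exponents from above.\<close>

lemma powr_bound_imp_le:
  fixes H D E w w' :: real
  assumes "D * H powr (- w) \<le> E * H powr (- w')" "1 \<le> H" "0 < D" "w < w'"
  shows "H \<le> (E / D) powr (1 / (w' - w))"
proof -
  have "D * H powr (- w) * H powr w' \<le> E * H powr (- w') * H powr w'"
    using assms(1) by (rule mult_right_mono) simp
  then have "D * H powr (w' - w) \<le> E"
    using assms(2) by (simp add: mult.assoc powr_add[symmetric] add.commute)
  then have "H powr (w' - w) \<le> E / D" using assms(3) by (simp add: field_simps)
  then have "(H powr (w' - w)) powr (1 / (w' - w)) \<le> (E / D) powr (1 / (w' - w))"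
    using assms(4) by (intro powr_mono2) auto
  then show ?thesis using assms by (simp add: powr_powr)
qed

text \<open>A version of the ultrametric estimate for \<open>ac_abs\<close>, from the triangle
  inequality alone. The radius 2 arises from |\<xi>| \<le> 1 and |\<xi> - \<alpha>| \<le> 1.\<close>

lemma absolute_value_poly_diff_le:
  fixes G :: "'b::field poly"
  assumes v: "absolute_value v" and G: "\<And>i. v (coeff G i) \<le> H" "degree G \<le> n"
    and x: "v x \<le> 1" and y: "v y \<le> 2"
  shows "v (poly G x - poly G y) \<le> 2 ^ Suc n * H * v (x - y)"
proof -
  have nonneg: "0 \<le> v z" and mult: "v (z * z') = v z * v z'" and add: "v (z + z') \<le> v z + v z'"
    and zero: "v 0 = 0" for z z'
    using v by (auto simp: absolute_value_def)
  \<comment> \<open>The bound on G(y) is carried along because the Horner step for the difference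
    uses it; 2^(n+1) - 1 is 1 + 2 + ... + 2^n.\<close>
  have "v (poly G y) \<le> (2 ^ Suc n - 1) * H \<and> v (poly G x - poly G y) \<le> 2 ^ Suc n * H * v (x - y)"
    using G
  proof (induction G arbitrary: n)
    case 0
    have "0 \<le> H" using 0(1)[of 0] zero by simp
    moreover have "(1::real) \<le> 2 ^ Suc n" by (rule one_le_power) simp
    ultimately show ?case using nonneg by (simp add: zero)
  next
    case (pCons c G)
    have H: "v (coeff G i) \<le> H" for i using pCons.prems(1)[of "Suc i"] by simp
    have c: "v c \<le> H" using pCons.prems(1)[of 0] by simp
    have H0: "0 \<le> H" using c nonneg[of c] by linarith
    show ?case
    proof (cases "G = 0")
      case True
      have "(2::real) ^ 1 \<le> 2 ^ Suc n" by (rule power_increasing) auto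
      then have "1 * H \<le> (2 ^ Suc n - 1) * H" using H0 by (intro mult_right_mono) auto
      then show ?thesis using True c H0 nonneg by (simp add: zero)
    next
      case False
      then obtain m where m: "n = Suc m" "degree G \<le> m" using pCons.prems(2) by (cases n) auto
      define B where "B = (2::real) ^ Suc m"
      have IH: "v (poly G y) \<le> (B - 1) * H" "v (poly G x - poly G y) \<le> B * H * v (x - y)"
        using pCons.IH[OF H m(2)] by (auto simp: B_def)
      have Bn: "2 ^ Suc n = 2 * B" by (simp add: B_def m)
      have "v (y * poly G y) \<le> 2 * ((B - 1) * H)"
        unfolding mult using IH y nonneg by (intro mult_mono) auto
      then have 1: "v (poly (pCons c G) y) \<le> (2 * B - 1) * H"
        using add[of c "y * poly G y"] c by (simp add: algebra_simps)
      have "v (x * (poly G x - poly G y)) \<le> 1 * (B * H * v (x - y))"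
        unfolding mult using IH x nonneg by (intro mult_mono) auto
      moreover have "v ((x - y) * poly G y) \<le> v (x - y) * (B * H)"
        unfolding mult using IH nonneg H0 by (intro mult_left_mono) (auto simp: algebra_simps)
      moreover have "poly (pCons c G) x - poly (pCons c G) y = x * (poly G x - poly G y) + (x - y) * poly G y"
        by (simp add: algebra_simps)
      ultimately have "v (poly (pCons c G) x - poly (pCons c G) y) \<le> 2 * B * H * v (x - y)"
        using add[of "x * (poly G x - poly G y)" "(x - y) * poly G y"] by (simp add: mult_ac)
      then show ?thesis using 1 unfolding Bn by blast
    qed
  qed
  then show ?thesis by blast
qed


text \<open>\<open>Y_growth\<close> serves the choice of a convergent, \<open>Y_le\<close> limits
  the loss when a linear factor is split off, and \<open>Y_eq\<close> makes the convergents at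
  multiples of \<open>l\<close> good enough for the exponent w.\<close>

locale fast_continued_fraction = frobenius_continued_fraction p k l Y a
  for p k l :: nat and Y :: "nat \<Rightarrow> nat" and a :: "nat \<Rightarrow> 'a::{field,finite} poly" +
  fixes d :: nat and w :: real
  assumes d: "1 \<le> d" and w: "2 * real d - 1 < w"
    and Y_le: "real (Y (Suc n)) \<le> w * real (Y n)"
    and Y_eq: "real (Y (Suc (j * l))) = w * real (Y (j * l))"
    and Y_growth: "real d * real (Y (Suc n)) \<le> w * (real (Y (Suc n)) - (real d - 1) * real (Y n))"
begin

definition A :: "nat \<Rightarrow> 'a poly poly" where "A n = [:- P n, Q n:]"

lemma w_ge_1: "1 \<le> w"
  using d w by linarith

lemma A_primitive: "primitive_poly (A n)" and A_minimal: "minimal_vanishing (A n) (to_ac (c n))"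
proof -
  have "P n * (- ((- 1) ^ n) * Q (Suc n)) + Q n * ((- 1) ^ n * P (Suc n))
      = (- 1) ^ n * (P (Suc n) * Q n - P n * Q (Suc n))"
    by (simp add: algebra_simps)
  also have "\<dots> = 1" by (simp add: det power_mult_distrib[symmetric])
  finally show "primitive_poly (A n)" "minimal_vanishing (A n) (to_ac (c n))"
    using linear_primitive_minimal_vanishing[OF Q_nonzero] unfolding A_def c_def by blast+
qed

lemma poly_height_A: "poly_height (A n) = fls_abs (fls_of_T (Q n))"
proof (rule antisym)
  obtain i where "fls_abs (fls_of_T (coeff (A n) i)) = poly_height (A n)" using poly_height_attained by blast
  moreover have "fls_abs (fls_of_T (coeff (A n) i)) \<le> fls_abs (fls_of_T (Q n))"
    using abs_P_less_Q[of n] fls.abs_nonneg[of "fls_of_T (Q n)"]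
    by (auto simp: A_def coeff_pCons fls_of_T.hom_uminus fls.abs_uminus fls_of_T.hom_zero fls.abs_zero split: nat.split)
  ultimately show "poly_height (A n) \<le> fls_abs (fls_of_T (Q n))" by simp
  show "fls_abs (fls_of_T (Q n)) \<le> poly_height (A n)"
    using coeff_le_poly_height[of "A n" 1] by (simp add: A_def)
qed

lemma abs_eval_A: "fls_abs (eval_fls (A n) \<xi>) = 1 / fls_abs (fls_of_T (Q (Suc n)))"
proof -
  have "fls_of_T (Q n) \<noteq> 0" using Q_nonzero by (simp add: fls_of_T.hom_eq_0_iff)
  then have "eval_fls (A n) \<xi> = fls_of_T (Q n) * (\<xi> - c n)"
    by (simp add: A_def eval_fls_linear c_def right_diff_distrib)
  then show ?thesis using abs_Q_pos[of n] by (simp add: fls.abs_mult abs_\<xi>_diff \<delta>_def)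
qed

section \<open>Lower bound for polynomials evaluated at \<xi>\<close>

lemma abs_Q_powr: "fls_abs (fls_of_T (Q n)) = real CARD('a) powr (real (Y n) - real (Y 0))"
  using q_gt_1 Y_ge_Y0[of n] by (simp add: abs_Q powr_realpow[symmetric] of_nat_diff)

text \<open>N is the least index with the first inequality. For N > 0, failure at N - 1 and
  \<open>Y_growth\<close> give the second; for N = 0 its left side is 0. Such an index exists
  because, by \<open>Y_growth\<close>, Y_(N+1) - (d-1) Y_N is unbounded.\<close>

lemma height_window:
  obtains N where "real h + (real d - 1) * (real (Y N) - real (Y 0)) < real (Y (Suc N)) - real (Y 0)"
    "real d * (real (Y N) - real (Y 0)) \<le> w * real h + w * real (Y 0)"
proof -
  define good where "good N \<longleftrightarrow> real h + (real d - 1) * (real (Y N) - real (Y 0)) < real (Y (Suc N)) - real (Y 0)" for N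
  have dY: "0 \<le> (real d - 1) * real (Y 0)" using d by simp
  have "\<exists>N. good N"
  proof -
    obtain N where N: "w * (real h + real (Y 0)) < real N" using reals_Archimedean2 by blast
    have "real N \<le> real d * real (Y (Suc N))"
    proof -
      have "1 * real (Y (Suc N)) \<le> real d * real (Y (Suc N))" using d by (intro mult_right_mono) auto
      moreover have "real N \<le> real (Y (Suc N))" using Y_ge[of "Suc N"] by simp
      ultimately show ?thesis by linarith
    qed
    then have "w * (real h + real (Y 0)) < w * (real (Y (Suc N)) - (real d - 1) * real (Y N))"
      using N Y_growth[of N] by linarith
    then have "real h + real (Y 0) < real (Y (Suc N)) - (real d - 1) * real (Y N)" using w_ge_1 by simp
    then have "good N" using dY by (simp add: good_def algebra_simps)
    then show ?thesis by blast
  qed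
  then have goodL: "good (LEAST N. good N)" by (rule LeastI_ex)
  define N where "N = (LEAST N. good N)"
  have "real d * (real (Y N) - real (Y 0)) \<le> w * real h + w * real (Y 0)"
  proof (cases N)
    case 0
    then show ?thesis using w_ge_1 by simp
  next
    case (Suc M)
    then have "\<not> good M" using not_less_Least[of M good] by (simp add: N_def)
    then have "real (Y N) - (real d - 1) * real (Y M) \<le> real h + real (Y 0)"
      using dY unfolding good_def Suc by (simp add: algebra_simps)
    then have "w * (real (Y N) - (real d - 1) * real (Y M)) \<le> w * (real h + real (Y 0))"
      using w_ge_1 by (intro mult_left_mono) auto
    then have "real d * real (Y N) \<le> w * (real h + real (Y 0))" using Y_growth[of M] Suc by simp
    moreover have "0 \<le> real d * real (Y 0)" by simp
    ultimately show ?thesis unfolding right_diff_distrib distrib_left by linarith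
  qed
  then show ?thesis using that goodL unfolding N_def good_def by blast
qed

lemma liouville_step:
  fixes G :: "'a poly poly"
  assumes n: "n \<le> d" and G: "G \<noteq> 0" "degree G \<le> n"
    and IH: "\<And>R. 0 < n \<Longrightarrow> R \<noteq> 0 \<Longrightarrow> degree R \<le> n - 1 \<Longrightarrow>
      D * poly_height R powr (- w) \<le> fls_abs (eval_fls R \<xi>)"
    and D: "0 < D" "D \<le> 1"
  shows "D * real CARD('a) powr (- (w * real (Y 0))) * poly_height G powr (- w) \<le> fls_abs (eval_fls G \<xi>)"
proof -
  define q where "q = real CARD('a)"
  have q: "1 < q" unfolding q_def by (rule q_gt_1)
  obtain h where h: "poly_height G = q ^ h" using poly_height_eq_power[OF G(1)] q_def by metis
  then have h': "poly_height G = q powr real h" using q by (simp add: powr_realpow)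
  obtain N where N: "real h + (real d - 1) * (real (Y N) - real (Y 0)) < real (Y (Suc N)) - real (Y 0)"
    "real d * (real (Y N) - real (Y 0)) \<le> w * real h + w * real (Y 0)"
    using height_window by blast
  have YN: "real (Y 0) \<le> real (Y N)" using Y_ge_Y0 by simp
  show ?thesis
  proof (cases "eval_fls G (c N) = 0")
    \<comment> \<open>|G(c_N)| is at least |Q_N|^(-d), and the first window inequality makes
      |G(\<xi>) - G(c_N)| smaller, so both values have the same size. The second one compares
      |Q_N|^(-d) with H(G)^(-w).\<close>
    case False
    have coeff: "fls_abs (coeff (map_poly fls_of_T G) i) \<le> poly_height G" for i
      by (simp add: coeff_map_poly fls_of_T.hom_zero coeff_le_poly_height)
    have "1 \<le> fls_abs (fls_of_T (Q N)) ^ n * fls_abs (eval_fls G (c N))"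
      using fls_abs_eval_at_fraction_ge[OF G(2) Q_nonzero] False by (simp add: c_def)
    also have "\<dots> \<le> fls_abs (fls_of_T (Q N)) ^ d * fls_abs (eval_fls G (c N))"
      using n q by (intro mult_right_mono power_increasing) (auto simp: abs_Q q_def fls.abs_nonneg)
    also have "fls_abs (fls_of_T (Q N)) ^ d = q powr (real d * (real (Y N) - real (Y 0)))"
      using q by (simp add: abs_Q_powr q_def powr_power mult.commute)
    finally have "1 \<le> q powr (real d * (real (Y N) - real (Y 0))) * fls_abs (eval_fls G (c N))" .
    then have "q powr (- (real d * (real (Y N) - real (Y 0)))) * 1 \<le>
        q powr (- (real d * (real (Y N) - real (Y 0)))) * (q powr (real d * (real (Y N) - real (Y 0))) * fls_abs (eval_fls G (c N)))"
      by (intro mult_left_mono) auto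
    then have lower: "q powr (- (real d * (real (Y N) - real (Y 0)))) \<le> fls_abs (eval_fls G (c N))"
      using q by (simp add: mult.assoc[symmetric] powr_add[symmetric])
    have "fls_abs (eval_fls G \<xi> - eval_fls G (c N)) \<le> poly_height G * fls_abs (\<xi> - c N)"
      unfolding eval_fls_def using abs_\<xi>_less_1 abs_c_less_1[of N]
      by (intro fls.abs_poly_diff_le coeff) auto
    also have "\<dots> = q powr (real h - (real (Y N) - real (Y 0)) - (real (Y (Suc N)) - real (Y 0)))"
      unfolding abs_\<xi>_diff \<delta>_def abs_Q_powr h' q_def powr_diff by simp
    also have "\<dots> < q powr (- (real d * (real (Y N) - real (Y 0))))"
    proof (rule powr_less_mono)
      have "real h + (real d * (real (Y N) - real (Y 0)) - (real (Y N) - real (Y 0))) < real (Y (Suc N)) - real (Y 0)"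
        using N(1) by (simp add: left_diff_distrib)
      then show "real h - (real (Y N) - real (Y 0)) - (real (Y (Suc N)) - real (Y 0)) < - (real d * (real (Y N) - real (Y 0)))"
        by linarith
    qed (use q in simp)
    finally have "fls_abs (eval_fls G \<xi> - eval_fls G (c N)) < fls_abs (eval_fls G (c N))" using lower by simp
    from fls.abs_add_eq[OF this] have "fls_abs (eval_fls G \<xi>) = fls_abs (eval_fls G (c N))" by simp
    moreover have "D * q powr (- (w * real (Y 0))) * poly_height G powr (- w) \<le> 1 * (q powr (- (w * real (Y 0))) * poly_height G powr (- w))"
      unfolding mult.assoc using D by (intro mult_right_mono) auto
    moreover have "q powr (- (w * real (Y 0))) * poly_height G powr (- w) \<le> q powr (- (real d * (real (Y N) - real (Y 0))))"
      unfolding h' powr_powr powr_add[symmetric] using N(2) q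
      by (intro powr_mono) (auto simp: algebra_simps)
    ultimately show ?thesis using lower unfolding q_def by linarith
  next
    \<comment> \<open>Now G = A_N R with H(R) \<le> H(G)/|Q_N| and |A_N(\<xi>)| = 1/|Q_(N+1)|. By
      \<open>Y_le\<close> the gain |Q_N|^w from the smaller height makes up for the loss |Q_(N+1)|
      up to the factor q^(-w Y_0).\<close>
    case True
    then have "eval_ac G (to_ac (c N)) = 0" by (simp add: eval_ac_to_ac)
    then obtain R where R: "G = A N * R"
      using primitive_minimal_vanishing_dvd[OF A_primitive A_minimal] by (metis dvdE)
    have "R \<noteq> 0" "A N \<noteq> 0" using R G by auto
    moreover have "degree (A N) = 1" using Q_nonzero by (simp add: A_def)
    ultimately have "degree G = 1 + degree R" by (simp add: R degree_mult_eq)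
    then have "0 < n" "degree R \<le> n - 1" using G by auto
    then have R_lower: "D * poly_height R powr (- w) \<le> fls_abs (eval_fls R \<xi>)" using IH \<open>R \<noteq> 0\<close> by blast
    have hR: "1 \<le> poly_height R" using \<open>R \<noteq> 0\<close> by (rule poly_height_ge_1)
    have "fls_abs (fls_of_T (Q N)) * poly_height R \<le> poly_height G"
      unfolding R A_def by (rule poly_height_linear_mult_ge[OF abs_P_less_Q])
    then have "poly_height R \<le> q powr (real h - (real (Y N) - real (Y 0)))"
      using q by (simp add: abs_Q_powr h' q_def powr_diff powr_add field_simps)
    then have "(q powr (real h - (real (Y N) - real (Y 0)))) powr (- w) \<le> poly_height R powr (- w)"
      using hR w_ge_1 by (intro powr_mono2') auto
    then have "q powr (- w * (real h - (real (Y N) - real (Y 0)))) \<le> poly_height R powr (- w)"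
      by (simp add: powr_powr mult.commute)
    then have "D * q powr (- w * (real h - (real (Y N) - real (Y 0)))) \<le> D * poly_height R powr (- w)"
      using D by (intro mult_left_mono) auto
    then have R_lower': "D * q powr (- w * (real h - (real (Y N) - real (Y 0)))) \<le> fls_abs (eval_fls R \<xi>)"
      using R_lower by linarith
    have "D * q powr (- (w * real (Y 0))) * poly_height G powr (- w) = D * q powr (- (w * real (Y 0)) - w * real h)"
    proof -
      have "- (w * real (Y 0)) - w * real h = - (w * real (Y 0)) + real h * - w" by simp
      then show ?thesis unfolding h' powr_powr by (simp only: powr_add mult.assoc)
    qed
    also have "\<dots> \<le> D * q powr (- (real (Y (Suc N)) - real (Y 0)) + (- w * (real h - (real (Y N) - real (Y 0)))))"
    proof (intro mult_left_mono powr_mono)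
      have "real (Y (Suc N)) \<le> w * real (Y N)" by (rule Y_le)
      then show "- (w * real (Y 0)) - w * real h \<le> - (real (Y (Suc N)) - real (Y 0)) + (- w * (real h - (real (Y N) - real (Y 0))))"
        by (simp add: algebra_simps)
    qed (use D q in auto)
    also have "\<dots> = q powr (- (real (Y (Suc N)) - real (Y 0))) * (D * q powr (- w * (real h - (real (Y N) - real (Y 0)))))"
      unfolding powr_add by (simp add: mult_ac)
    also have "\<dots> \<le> q powr (- (real (Y (Suc N)) - real (Y 0))) * fls_abs (eval_fls R \<xi>)"
      using R_lower' by (intro mult_left_mono) auto
    also have "q powr (- (real (Y (Suc N)) - real (Y 0))) = fls_abs (eval_fls (A N) \<xi>)"
      unfolding abs_eval_A abs_Q_powr q_def by (rule powr_minus_divide)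
    finally show ?thesis by (simp add: R eval_fls_mult fls.abs_mult q_def)
  qed
qed

text \<open>Each degree costs one factor \<open>K\<close>, whence the constant K^(d+1).\<close>

lemma liouville:
  obtains D where "0 < D" "\<And>G. G \<noteq> 0 \<Longrightarrow> degree G \<le> d \<Longrightarrow>
    D * poly_height G powr (- w) \<le> fls_abs (eval_fls G \<xi>)"
proof -
  define K where "K = real CARD('a) powr (- (w * real (Y 0)))"
  have "K \<le> real CARD('a) powr 0" unfolding K_def using q_gt_1 w_ge_1 by (intro powr_mono) auto
  then have K: "0 < K" "K \<le> 1" using q_gt_1 by (auto simp: K_def)
  have main: "n \<le> d \<Longrightarrow> G \<noteq> 0 \<Longrightarrow> degree G \<le> n \<Longrightarrow> K ^ Suc n * poly_height G powr (- w) \<le> fls_abs (eval_fls G \<xi>)"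
    for n G
  proof (induction n arbitrary: G)
    case 0
    then show ?case using liouville_step[of 0 G 1] by (simp add: K_def)
  next
    case (Suc n)
    have "K ^ Suc n * real CARD('a) powr (- (w * real (Y 0))) * poly_height G powr (- w) \<le> fls_abs (eval_fls G \<xi>)"
      using Suc.prems Suc.IH K by (intro liouville_step[of "Suc n"]) (auto simp: power_le_one mult_le_one)
    then show ?case by (simp add: K_def mult_ac)
  qed
  show ?thesis using that[of "K ^ Suc d"] main[of d] K by simp
qed

end

section \<open>Values of the exponents\<close>

context fast_continued_fraction
begin

lemma finite_w_exp_set:
  assumes "n \<le> d" "w < w'"
  shows "finite {G. degree G \<le> n \<and> 0 < fls_abs (eval_fls G \<xi>) \<and>
    fls_abs (eval_fls G \<xi>) \<le> poly_height G powr (- w')}"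
proof -
  obtain D where D: "0 < D" "\<And>G. G \<noteq> 0 \<Longrightarrow> degree G \<le> d \<Longrightarrow>
    D * poly_height G powr (- w) \<le> fls_abs (eval_fls G \<xi>)" using liouville by blast
  show ?thesis
  proof (rule finite_subset)
    show "{G. degree G \<le> n \<and> 0 < fls_abs (eval_fls G \<xi>) \<and> fls_abs (eval_fls G \<xi>) \<le> poly_height G powr (- w')}
      \<subseteq> {G. degree G \<le> n \<and> poly_height G \<le> (1 / D) powr (1 / (w' - w))}"
    proof (intro subsetI CollectI; elim CollectE conjE; intro conjI)
      fix G assume G: "degree G \<le> n" "0 < fls_abs (eval_fls G \<xi>)" "fls_abs (eval_fls G \<xi>) \<le> poly_height G powr (- w')"
      have "G \<noteq> 0" using G(2) by (auto simp: eval_fls_def fls.abs_zero)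
      then have "D * poly_height G powr (- w) \<le> 1 * poly_height G powr (- w')" using D(2)[of G] G assms by simp
      then show "poly_height G \<le> (1 / D) powr (1 / (w' - w))"
        using D(1) assms(2) poly_height_ge_1[OF \<open>G \<noteq> 0\<close>] by (intro powr_bound_imp_le) auto
    qed
  qed (rule finite_bounded_height)
qed

text \<open>With G the minimal polynomial of \<alpha>, the value G(\<xi>) = G(\<xi>) - G(\<alpha>)
  is at most a constant times H |\<xi> - \<alpha>|. The extra -1 in the exponent cancels H, and
  \<open>liouville\<close> leaves finitely many G, hence finitely many roots \<alpha>.\<close>

lemma finite_w_star_exp_set:
  assumes "n \<le> d" "w < w'"
  shows "finite {\<alpha>. algebraic_T \<alpha> \<and> alg_degree \<alpha> \<le> n \<and> 0 < ac_abs (to_ac \<xi> - \<alpha>) \<and>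
    ac_abs (to_ac \<xi> - \<alpha>) \<le> alg_height \<alpha> powr (- w' - 1)}"
proof -
  obtain D where D: "0 < D" "\<And>G. G \<noteq> 0 \<Longrightarrow> degree G \<le> d \<Longrightarrow>
    D * poly_height G powr (- w) \<le> fls_abs (eval_fls G \<xi>)" using liouville by blast
  define S where "S = {G :: 'a poly poly. degree G \<le> n \<and> poly_height G \<le> (2 ^ Suc n / D) powr (1 / (w' - w))}"
  have "finite (\<Union>G\<in>S - {0}. {\<alpha>. eval_ac G \<alpha> = 0})"
  proof (intro finite_UN_I)
    show "finite (S - {0})" unfolding S_def using finite_bounded_height by blast
    fix G assume "G \<in> S - {0}"
    then show "finite {\<alpha>. eval_ac G \<alpha> = 0}"
      unfolding eval_ac_def by (intro poly_roots_finite) (simp add: ac_of_T.map_poly_hom_eq_0_iff)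
  qed
  moreover have "\<alpha> \<in> (\<Union>G\<in>S - {0}. {\<alpha>. eval_ac G \<alpha> = 0})"
    if \<alpha>: "algebraic_T \<alpha>" "alg_degree \<alpha> \<le> n" "ac_abs (to_ac \<xi> - \<alpha>) \<le> alg_height \<alpha> powr (- w' - 1)" for \<alpha>
  proof -
    define G where "G = min_poly_T \<alpha>"
    have G: "G \<noteq> 0" "eval_ac G \<alpha> = 0" "degree G \<le> n"
      using min_poly_T_props[OF \<alpha>(1)] \<alpha>(2) by (auto simp: G_def minimal_vanishing_def alg_degree_def)
    have H1: "1 \<le> poly_height G" using G(1) by (rule poly_height_ge_1)
    have \<alpha>3: "ac_abs (to_ac \<xi> - \<alpha>) \<le> poly_height G powr (- w' - 1)"
      using \<alpha>(3) by (simp add: alg_height_def G_def)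
    also have "\<dots> \<le> poly_height G powr 0" using H1 w_ge_1 assms by (intro powr_mono) auto
    finally have le_1: "ac_abs (to_ac \<xi> - \<alpha>) \<le> 1" using H1 by simp
    note v = ac_abs_absolute_value[where 'a = 'a]
    have "ac_abs (- 1 * (to_ac \<xi> - \<alpha>)) = ac_abs (- 1 :: 'a fls alg_closure) * ac_abs (to_ac \<xi> - \<alpha>)"
      using v unfolding absolute_value_def by blast
    moreover have "ac_abs (- 1 :: 'a fls alg_closure) = 1"
      using ac_abs_to_ac[of "- 1 :: 'a fls"] by (simp add: fls.abs_uminus fls.abs_one)
    ultimately have "ac_abs (\<alpha> - to_ac \<xi>) \<le> 1" using le_1 by simp
    moreover have "ac_abs (to_ac \<xi> + (\<alpha> - to_ac \<xi>)) \<le> ac_abs (to_ac \<xi>) + ac_abs (\<alpha> - to_ac \<xi>)"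
      using v unfolding absolute_value_def by blast
    ultimately have \<alpha>2: "ac_abs \<alpha> \<le> 2" using abs_\<xi>_less_1 by (simp add: ac_abs_to_ac)
    define GK where "GK = map_poly (\<lambda>a. to_ac (fls_of_T a)) G"
    have "ac_abs (poly GK (to_ac \<xi>) - poly GK \<alpha>) \<le> 2 ^ Suc n * poly_height G * ac_abs (to_ac \<xi> - \<alpha>)"
    proof (rule absolute_value_poly_diff_le[OF v])
      show "ac_abs (coeff GK i) \<le> poly_height G" for i
        by (simp add: GK_def coeff_map_poly fls_of_T.hom_zero ac_abs_to_ac coeff_le_poly_height)
      show "degree GK \<le> n" using G(3) by (simp add: GK_def ac_of_T.degree_map_poly_hom)
    qed (use \<alpha>2 abs_\<xi>_less_1 in \<open>auto simp: ac_abs_to_ac\<close>)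
    moreover have "poly GK \<alpha> = 0" "poly GK (to_ac \<xi>) = to_ac (eval_fls G \<xi>)"
      using G(2) eval_ac_to_ac[of G \<xi>] by (auto simp: GK_def eval_ac_def)
    ultimately have "fls_abs (eval_fls G \<xi>) \<le> 2 ^ Suc n * poly_height G * ac_abs (to_ac \<xi> - \<alpha>)"
      by (simp add: ac_abs_to_ac)
    also have "\<dots> \<le> 2 ^ Suc n * poly_height G * poly_height G powr (- w' - 1)"
      using \<alpha>3 H1 by (intro mult_left_mono) auto
    also have "\<dots> = 2 ^ Suc n * poly_height G powr (- w')"
      using H1 by (simp add: powr_diff)
    finally have "D * poly_height G powr (- w) \<le> 2 ^ Suc n * poly_height G powr (- w')"
      using D(2)[OF G(1)] G(3) assms(1) by simp
    then have "poly_height G \<le> (2 ^ Suc n / D) powr (1 / (w' - w))"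
      using D(1) assms(2) H1 by (intro powr_bound_imp_le) auto
    then show ?thesis using G by (auto simp: S_def)
  qed
  ultimately show ?thesis by (rule_tac finite_subset) auto
qed

text \<open>At the start of a block Y_(n+1) = w Y_n, and the shift by Y_0 acts in the favourable
  direction since w \<ge> 1.\<close>

lemma abs_Q_Suc_ge: "fls_abs (fls_of_T (Q (j * l))) powr w \<le> fls_abs (fls_of_T (Q (Suc (j * l))))"
  unfolding abs_Q_powr powr_powr
proof (rule powr_mono)
  have "1 * real (Y 0) \<le> w * real (Y 0)" using w_ge_1 by (intro mult_right_mono) auto
  then show "(real (Y (j * l)) - real (Y 0)) * w \<le> real (Y (Suc (j * l))) - real (Y 0)"
    unfolding Y_eq by (simp add: algebra_simps)
qed (use q_gt_1 in simp)

lemma inj_block: "inj (\<lambda>j. \<delta> (j * l))"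
proof (rule injI)
  fix i j assume "\<delta> (i * l) = \<delta> (j * l)"
  then have "i * l = j * l" using \<delta>_less[of "i * l" "j * l"] \<delta>_less[of "j * l" "i * l"] by (cases "i * l" "j * l" rule: linorder_cases) auto
  then show "i = j" using l by simp
qed

lemma infinite_w_exp_set:
  assumes "1 \<le> n"
  shows "infinite {G. degree G \<le> n \<and> 0 < fls_abs (eval_fls G \<xi>) \<and>
    fls_abs (eval_fls G \<xi>) \<le> poly_height G powr (- w)}"
proof (rule infinite_super)
  show "range (\<lambda>j. A (j * l)) \<subseteq> {G. degree G \<le> n \<and> 0 < fls_abs (eval_fls G \<xi>) \<and>
    fls_abs (eval_fls G \<xi>) \<le> poly_height G powr (- w)}"
  proof (rule image_subsetI, intro CollectI conjI)
    fix j
    show "degree (A (j * l)) \<le> n" using assms Q_nonzero by (simp add: A_def)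
    show "0 < fls_abs (eval_fls (A (j * l)) \<xi>)" by (simp add: abs_eval_A abs_Q_pos)
    show "fls_abs (eval_fls (A (j * l)) \<xi>) \<le> poly_height (A (j * l)) powr (- w)"
      unfolding abs_eval_A poly_height_A powr_minus_divide
      using abs_Q_Suc_ge[of j] abs_Q_pos[of "j * l"] abs_Q_pos[of "Suc (j * l)"]
      by (intro divide_left_mono mult_pos_pos) auto
  qed
  have "inj (\<lambda>j. A (j * l))"
  proof (rule injI)
    fix i j assume "A (i * l) = A (j * l)"
    then have "c (i * l) = c (j * l)" by (simp add: A_def c_def)
    then have "\<delta> (i * l) = \<delta> (j * l)" by (simp flip: abs_\<xi>_diff)
    then show "i = j" using inj_block by (auto dest: injD)
  qed
  then show "infinite (range (\<lambda>j. A (j * l)))" by (rule range_inj_infinite)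
qed

lemma min_poly_c: "min_poly_T (to_ac (c n)) = A n"
  using conjunct2[OF degree_lead_coeff_Q[of n]] Q_nonzero[of n]
  by (intro min_poly_T_eqI A_primitive A_minimal) (auto simp add: A_def)

text \<open>At N = j l the convergent has height |Q_N| and distance 1/(|Q_N| |Q_(N+1)|) \<le>
  |Q_N|^(-1-w) from \<xi>.\<close>

lemma infinite_w_star_exp_set:
  assumes "1 \<le> n"
  shows "infinite {\<alpha>. algebraic_T \<alpha> \<and> alg_degree \<alpha> \<le> n \<and> 0 < ac_abs (to_ac \<xi> - \<alpha>) \<and>
    ac_abs (to_ac \<xi> - \<alpha>) \<le> alg_height \<alpha> powr (- w - 1)}"
proof (rule infinite_super)
  show "range (\<lambda>j. to_ac (c (j * l))) \<subseteq> {\<alpha>. algebraic_T \<alpha> \<and> alg_degree \<alpha> \<le> n \<and>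
    0 < ac_abs (to_ac \<xi> - \<alpha>) \<and> ac_abs (to_ac \<xi> - \<alpha>) \<le> alg_height \<alpha> powr (- w - 1)}"
  proof (rule image_subsetI, intro CollectI conjI)
    fix j
    show "algebraic_T (to_ac (c (j * l)))"
      using A_minimal[of "j * l"] by (auto simp: algebraic_T_def minimal_vanishing_def)
    show "alg_degree (to_ac (c (j * l))) \<le> n"
      using assms Q_nonzero by (simp add: alg_degree_def min_poly_c A_def)
    have abs: "ac_abs (to_ac \<xi> - to_ac (c (j * l))) = \<delta> (j * l)"
      by (simp add: ac_abs_to_ac abs_\<xi>_diff flip: to_ac_diff)
    then show "0 < ac_abs (to_ac \<xi> - to_ac (c (j * l)))" by (simp add: \<delta>_pos)
    define t where "t = fls_abs (fls_of_T (Q (j * l)))"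
    have t: "0 < t" by (simp add: t_def abs_Q_pos)
    have "\<delta> (j * l) \<le> 1 / (t * t powr w)"
      unfolding \<delta>_def t_def[symmetric] using abs_Q_Suc_ge[of j] t
        abs_Q_pos[of "Suc (j * l)"]
      by (intro divide_left_mono mult_left_mono mult_pos_pos) (auto simp flip: t_def)
    also have "\<dots> = t powr (- w - 1)"
      using t by (simp add: powr_diff powr_minus field_simps)
    finally show "ac_abs (to_ac \<xi> - to_ac (c (j * l))) \<le> alg_height (to_ac (c (j * l))) powr (- w - 1)"
      unfolding abs alg_height_def min_poly_c poly_height_A t_def[symmetric] .
  qed
  have "inj (\<lambda>j. to_ac (c (j * l)))"
  proof (rule injI)
    fix i j assume "to_ac (c (i * l)) = to_ac (c (j * l))"
    then have "\<delta> (i * l) = \<delta> (j * l)" by (simp flip: abs_\<xi>_diff)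
    then show "i = j" using inj_block by (auto dest: injD)
  qed
  then show "infinite (range (\<lambda>j. to_ac (c (j * l))))" by (rule range_inj_infinite)
qed

lemma w_exp_\<xi>:
  assumes "n \<in> {1..d}"
  shows "w_exp n \<xi> = ereal w"
  unfolding w_exp_def
proof (rule antisym)
  show "Sup {ereal w | w. infinite {G. degree G \<le> n \<and> 0 < fls_abs (eval_fls G \<xi>) \<and>
      fls_abs (eval_fls G \<xi>) \<le> poly_height G powr (- w)}} \<le> ereal w"
    by (rule Sup_least) (use finite_w_exp_set[of n] assms in \<open>force simp: not_less[symmetric]\<close>)
qed (use infinite_w_exp_set[of n] assms in \<open>auto intro!: Sup_upper\<close>)

lemma w_star_exp_\<xi>:
  assumes "n \<in> {1..d}"
  shows "w_star_exp n \<xi> = ereal w"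
  unfolding w_star_exp_def
proof (rule antisym)
  show "Sup {ereal w | w. infinite {\<alpha>. algebraic_T \<alpha> \<and> alg_degree \<alpha> \<le> n \<and> 0 < ac_abs (to_ac \<xi> - \<alpha>) \<and>
      ac_abs (to_ac \<xi> - \<alpha>) \<le> alg_height \<alpha> powr (- w - 1)}} \<le> ereal w"
    by (rule Sup_least) (use finite_w_star_exp_set[of n] assms in \<open>force simp: not_less[symmetric]\<close>)
qed (use infinite_w_star_exp_set[of n] assms in \<open>auto intro!: Sup_upper\<close>)

text \<open>The lower bound in \<open>liouville\<close> is positive. Since d \<ge> 1, this gives
  irrationality here and degree at least 2 later.\<close>

lemma eval_\<xi>_nonzero: "G \<noteq> 0 \<Longrightarrow> degree G \<le> d \<Longrightarrow> eval_fls G \<xi> \<noteq> 0"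
proof
  assume G: "G \<noteq> 0" "degree G \<le> d" "eval_fls G \<xi> = 0"
  obtain D where "0 < D" "D * poly_height G powr (- w) \<le> fls_abs (eval_fls G \<xi>)"
    using liouville G by metis
  moreover have "0 < poly_height G powr (- w)" using poly_height_ge_1[OF G(1)] by simp
  ultimately show False using G(3) by (simp add: fls.abs_zero mult_le_0_iff)
qed

lemma \<xi>_notin_rat_funs: "\<xi> \<notin> rat_funs"
proof
  assume "\<xi> \<in> rat_funs"
  then obtain u v where uv: "v \<noteq> 0" "\<xi> = fls_of_T u / fls_of_T v" by (auto simp: rat_funs_def)
  then have "eval_fls [:- u, v:] \<xi> = 0" by (simp add: eval_fls_linear fls_of_T.hom_eq_0_iff)
  then show False using eval_\<xi>_nonzero[of "[:- u, v:]"] uv(1) d by simp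
qed

end

section \<open>The algebraic degree\<close>

lemma (in ultrametric_abs) abs_prod_linear_at_0:
  "(\<And>x. x \<in># M \<Longrightarrow> v x ^ r = t) \<Longrightarrow> v (poly (\<Prod>x\<in>#M. [:- x, 1:]) 0) ^ r = t ^ size M"
  by (induction M) (auto simp: abs_one abs_mult abs_uminus power_mult_distrib)

context fast_continued_fraction
begin

definition F :: "'a poly poly" where
  "F = Polynomial.monom (Q (l - 1)) (Suc r) - Polynomial.monom (P (l - 1)) r + [:- P l, Q l:]"

text \<open>This is F(\<xi> + Z)/Z, as \<open>pcompose_F\<close> shows. The middle coefficient is V
  \<xi> - R when F is written V X^(r+1) - R X^r + U X - S.\<close>

definition cofactor :: "'a fls poly" where
  "cofactor = [:fls_of_T (Q (l - 1)):] * [:0, 1:] ^ r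
    + [:eval_fls (A (l - 1)) \<xi>:] * [:0, 1:] ^ (r - 1)
    + [:fls_of_T (Q (l - 1)) * \<xi> ^ r + fls_of_T (Q l):]"

lemma degree_F: "degree F \<le> Suc r" and F_nonzero: "F \<noteq> 0"
proof -
  have "degree F \<le> max (max (Suc r) r) 1"
    unfolding F_def by (intro degree_add_le_max[THEN order.trans] max.mono degree_diff_le_max[THEN order.trans] degree_monom_le) auto
  then show "degree F \<le> Suc r" by simp
  have "coeff F (Suc r) = Q (l - 1)"
    using r_pos by (auto simp: F_def coeff_pCons split: nat.split)
  then show "F \<noteq> 0" using Q_nonzero by force
qed

lemma eval_F: "eval_fls F x = x * (fls_of_T (Q (l - 1)) * x ^ r + fls_of_T (Q l))
    - (fls_of_T (P (l - 1)) * x ^ r + fls_of_T (P l))"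
  by (simp add: F_def eval_fls_def fls_of_T.map_poly_hom_add fls_of_T.map_poly_hom_diff map_poly_monom
      fls_of_T.hom_zero map_poly_pCons fls_of_T.hom_uminus poly_monom algebra_simps)

lemma eval_F_\<xi>: "eval_fls F \<xi> = 0"
  unfolding eval_F \<xi>_equation by simp

lemma algebraic_\<xi>: "algebraic_T (to_ac \<xi>)"
  unfolding algebraic_T_def using F_nonzero eval_F_\<xi> by (intro exI[of _ F]) (simp add: eval_ac_to_ac)

text \<open>Additivity of r-th powers leaves only Z^(r+1), Z^r, Z and a constant term, and the
  constant term vanishes by \<open>\<xi>_equation\<close>.\<close>

lemma pcompose_F: "pcompose (map_poly fls_of_T F) [:\<xi>, 1:] = [:0, 1:] * cofactor"
proof -
  define V U R S Z x0 Zr where "V = [:fls_of_T (Q (l - 1)):]" and "U = [:fls_of_T (Q l):]"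
    and "R = [:fls_of_T (P (l - 1)):]" and "S = [:fls_of_T (P l):]"
    and "Z = [:0, 1 :: 'a fls:]" and "x0 = [:\<xi>:]" and "Zr = Z ^ (r - 1)"
  have const_pow: "[:\<xi> ^ m:] = x0 ^ m" for m
    by (simp add: x0_def poly_const_pow)
  have "[:\<xi>, 1:] = x0 + Z" by (simp add: x0_def Z_def)
  moreover have "(x0 + Z) ^ r = x0 ^ r + Z ^ r" by (rule CHAR_power_add) (simp add: CHAR)
  moreover have Zr: "Z ^ r = Z * Zr" using r_pos by (cases r) (simp_all add: Zr_def)
  moreover have monom: "pcompose (Polynomial.monom b m) W = [:b:] * W ^ m" for b m and W :: "'a fls poly"
    by (induction m) (simp_all add: monom_0 monom_Suc pcompose_pCons mult_ac)
  ultimately have 1: "pcompose (map_poly fls_of_T F) [:\<xi>, 1:] =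
      V * ((x0 + Z) * (x0 ^ r + Z * Zr)) - R * (x0 ^ r + Z * Zr) + (- S + U * (x0 + Z))"
    by (simp add: F_def fls_of_T.map_poly_hom_add fls_of_T.map_poly_hom_diff map_poly_monom
        fls_of_T.hom_zero map_poly_pCons fls_of_T.hom_uminus pcompose_add pcompose_diff pcompose_pCons
        V_def U_def R_def S_def)
  have "[:\<xi> * (fls_of_T (Q (l - 1)) * \<xi> ^ r + fls_of_T (Q l)):] = [:fls_of_T (P (l - 1)) * \<xi> ^ r + fls_of_T (P l):]"
    by (simp only: \<xi>_equation)
  then have e: "x0 * (V * x0 ^ r + U) = R * x0 ^ r + S"
    by (simp add: V_def U_def R_def S_def const_pow[symmetric]) (simp add: x0_def mult.commute)
  have 2: "cofactor = V * (Z * Zr) + (V * x0 - R) * Zr + (V * x0 ^ r + U)"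
    unfolding cofactor_def A_def eval_fls_linear Z_def[symmetric] Zr Zr_def[symmetric]
    by (simp add: V_def U_def R_def const_pow[symmetric]) (simp add: x0_def mult.commute)
  have "V * ((x0 + Z) * (x0 ^ r + Z * Zr)) - R * (x0 ^ r + Z * Zr) + (- S + U * (x0 + Z))
      = Z * (V * (Z * Zr) + (V * x0 - R) * Zr + (V * x0 ^ r + U)) + (x0 * (V * x0 ^ r + U) - (R * x0 ^ r + S))"
    by (simp add: algebra_simps)
  then show ?thesis unfolding 1 2 e Z_def[symmetric] by simp
qed

text \<open>The Newton polygon has a single slope. If |\<beta>| \<le> 1, the constant term dominates
  and cannot cancel; if |\<beta>| > 1, the leading term dominates the one of degree r - 1 because
  |\<epsilon>| \<le> 1 \<le> |V|, and must balance the constant term.\<close>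

lemma abs_cofactor_root:
  assumes v: "ultrametric_abs v" "\<And>x :: 'a fls. v (to_ac x) = fls_abs x"
    and \<beta>: "poly (map_poly to_ac cofactor) \<beta> = 0"
  shows "v \<beta> ^ r = real CARD('a) ^ (Y l - Y (l - 1))"
proof -
  interpret ultrametric_abs v by (rule v)
  define V \<epsilon> C where "V = fls_of_T (Q (l - 1))" and "\<epsilon> = eval_fls (A (l - 1)) \<xi>"
    and "C = fls_of_T (Q (l - 1)) * \<xi> ^ r + fls_of_T (Q l)"
  have monom: "[:0, 1 :: 'a fls:] ^ m = Polynomial.monom 1 m" for m
    by (simp add: monom_altdef)
  have cof: "cofactor = Polynomial.monom V r + Polynomial.monom \<epsilon> (r - 1) + [:C:]"
    by (simp add: cofactor_def V_def \<epsilon>_def C_def monom smult_monom)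
  have eq: "(to_ac V * \<beta> ^ r + to_ac \<epsilon> * \<beta> ^ (r - 1)) + to_ac C = 0"
    using \<beta> by (simp add: cof to_ac.map_poly_hom_add map_poly_monom poly_monom map_poly_pCons)
  have V1: "1 \<le> fls_abs V" unfolding V_def using Q_nonzero by (rule fls_abs_fls_of_T_ge_1)
  have VU: "fls_abs V < fls_abs (fls_of_T (Q l))" using abs_Q_less[of "l - 1"] l by (simp add: V_def)
  have C: "fls_abs C = fls_abs (fls_of_T (Q l))" unfolding C_def by (rule abs_denominator)
  have \<epsilon>: "fls_abs \<epsilon> \<le> 1" using V1 VU l by (simp add: \<epsilon>_def abs_eval_A)
  have r1: "\<beta> ^ r = \<beta> * \<beta> ^ (r - 1)" using r_pos by (cases r) simp_all
  have "1 < v \<beta>"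
  proof (rule ccontr)
    assume "\<not> 1 < v \<beta>"
    then have pow: "v \<beta> ^ m \<le> 1" for m by (simp add: power_le_one abs_nonneg)
    have "v (to_ac V * \<beta> ^ r) \<le> fls_abs V * 1"
      unfolding abs_mult abs_power v(2) using V1 by (intro mult_left_mono pow) auto
    moreover have "v (to_ac \<epsilon> * \<beta> ^ (r - 1)) \<le> 1 * 1"
      unfolding abs_mult abs_power v(2) using \<epsilon> by (intro mult_mono pow) (auto simp: abs_nonneg)
    ultimately have "v (to_ac V * \<beta> ^ r + to_ac \<epsilon> * \<beta> ^ (r - 1)) < v (to_ac C)"
      using abs_add_le[of "to_ac V * \<beta> ^ r" "to_ac \<epsilon> * \<beta> ^ (r - 1)"] V1 VU C by (simp add: v(2))
    from abs_add_eq[OF this] eq have "v (to_ac C) = 0" by (simp add: abs_zero)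
    then show False using V1 VU C by (simp add: v(2))
  qed
  then have pos: "0 < v \<beta> ^ (r - 1)" by simp
  have "v (to_ac \<epsilon> * \<beta> ^ (r - 1)) \<le> 1 * v \<beta> ^ (r - 1)"
    unfolding abs_mult abs_power v(2) using \<epsilon> pos by (intro mult_right_mono) auto
  also have "\<dots> < v \<beta> * v \<beta> ^ (r - 1)" using \<open>1 < v \<beta>\<close> pos by (intro mult_strict_right_mono)
  also have "\<dots> \<le> fls_abs V * (v \<beta> * v \<beta> ^ (r - 1))"
    using mult_right_mono[OF V1, of "v \<beta> * v \<beta> ^ (r - 1)"] by (simp add: abs_nonneg)
  also have "\<dots> = v (to_ac V * \<beta> ^ r)" by (simp add: abs_mult abs_power v(2) r1)
  finally have "v (to_ac V * \<beta> ^ r + to_ac \<epsilon> * \<beta> ^ (r - 1)) = v (to_ac V * \<beta> ^ r)" by (rule abs_add_eq')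
  moreover have "to_ac V * \<beta> ^ r + to_ac \<epsilon> * \<beta> ^ (r - 1) = - to_ac C" using eq by (simp add: eq_neg_iff_add_eq_0)
  ultimately have "fls_abs V * v \<beta> ^ r = fls_abs C" by (simp add: abs_uminus abs_mult abs_power v(2))
  moreover have "fls_abs C = fls_abs V * real CARD('a) ^ (Y l - Y (l - 1))"
  proof -
    have "Y (l - 1) < Y l" using Y_Suc[of "l - 1"] l by simp
    then show ?thesis using Y_ge_Y0[of "l - 1"] unfolding C V_def abs_Q by (simp flip: power_add)
  qed
  ultimately show ?thesis using V1 by simp
qed

lemma alg_degree_\<xi>:
  assumes k: "0 < k" and pY: "\<not> p dvd Y (l - 1)"
  shows "alg_degree (to_ac \<xi>) = p ^ k + 1"
proof -
  obtain v :: "'a fls alg_closure \<Rightarrow> real"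
    where v: "ultrametric_abs v" "\<And>x. v (to_ac x) = fls_abs x"
    using ultrametric_extension_exists by blast
  interpret ultrametric_abs v by (rule v)
  define M where "M = min_poly_T (to_ac \<xi>)"
  have M: "primitive_poly M" "minimal_vanishing M (to_ac \<xi>)"
    using min_poly_T_props[OF algebraic_\<xi>] by (auto simp: M_def)
  have eval_M: "eval_fls M \<xi> = 0" and M0: "M \<noteq> 0" using M(2) by (auto simp: minimal_vanishing_def eval_ac_to_ac)
  have "M dvd F" using primitive_minimal_vanishing_dvd[OF M] eval_F_\<xi> by (simp add: eval_ac_to_ac)
  then obtain N where N: "F = M * N" by (auto elim: dvdE)
  have deg_le: "degree M \<le> Suc r"
    using dvd_imp_degree_le[OF \<open>M dvd F\<close> F_nonzero] degree_F by simp
  have deg_ge: "2 \<le> degree M" using eval_\<xi>_nonzero[of M] eval_M M0 d by linarith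
  define G where "G = pcompose (map_poly fls_of_T M) [:\<xi>, 1:]"
  have "coeff G 0 = 0" using eval_M by (simp add: G_def eval_fls_def)
  then obtain G1 where G1: "G = [:0, 1:] * G1" by (cases G) auto
  have "degree G = degree M" by (simp add: G_def degree_pcompose fls_of_T.degree_map_poly_hom)
  moreover have "G1 \<noteq> 0" using calculation G1 deg_ge by auto
  ultimately have deg_G1: "Suc (degree G1) = degree M" by (simp add: G1 degree_mult_eq)
  have "[:0, 1:] * cofactor = [:0, 1:] * (G1 * pcompose (map_poly fls_of_T N) [:\<xi>, 1:])"
    unfolding pcompose_F[symmetric] N fls_of_T.map_poly_hom_mult pcompose_mult G_def[symmetric] G1
    by (simp only: mult.assoc)
  then have cof: "cofactor = G1 * pcompose (map_poly fls_of_T N) [:\<xi>, 1:]" by simp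
  define GK where "GK = map_poly to_ac G1"
  have GK: "GK \<noteq> 0" "degree GK = degree G1" using \<open>G1 \<noteq> 0\<close>
    by (auto simp: GK_def to_ac.map_poly_hom_eq_0_iff to_ac.degree_map_poly_hom)
  obtain B where B: "size B = degree GK" "GK = smult (lead_coeff GK) (\<Prod>x\<in>#B. [:- x, 1:])"
    using alg_closed_imp_factorization[OF GK(1)] by blast
  have root: "v x ^ r = real CARD('a) ^ (Y l - Y (l - 1))" if "x \<in># B" for x
  proof (rule abs_cofactor_root[OF v])
    have "[:- x, 1:] dvd (\<Prod>x\<in>#B. [:- x, 1:])" using that by (intro dvd_prod_mset) auto
    then have "poly GK x = 0" using B(2) by (metis dvd_smult poly_eq_0_iff_dvd)
    then show "poly (map_poly to_ac cofactor) x = 0"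
      by (simp add: cof to_ac.map_poly_hom_mult GK_def)
  qed
  define g0 lc where "g0 = coeff G1 0" and "lc = lead_coeff G1"
  have lc: "lc \<noteq> 0" using \<open>G1 \<noteq> 0\<close> by (simp add: lc_def)
  have GK_vals: "poly GK 0 = to_ac g0" "lead_coeff GK = to_ac lc"
    using GK(2) by (simp_all add: GK_def poly_0_coeff_0 coeff_map_poly g0_def lc_def)
  have "v (poly GK 0) ^ r = v (lead_coeff GK) ^ r * v (poly (\<Prod>x\<in>#B. [:- x, 1:]) 0) ^ r"
    by (subst B(2)) (simp add: abs_mult power_mult_distrib)
  also have "v (poly (\<Prod>x\<in>#B. [:- x, 1:]) 0) ^ r = (real CARD('a) ^ (Y l - Y (l - 1))) ^ degree G1"
    using abs_prod_linear_at_0[of B r, OF root] B(1) GK(2) by simp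
  finally have eq: "fls_abs g0 ^ r = fls_abs lc ^ r * real CARD('a) ^ ((Y l - Y (l - 1)) * degree G1)"
    by (simp add: GK_vals v(2) power_mult)
  have "g0 \<noteq> 0"
  proof
    assume "g0 = 0"
    then show False using eq r_pos lc q_gt_1 by (simp add: fls.abs_zero fls.abs_eq_0_iff zero_power)
  qed
  define m where "m = (Y l - Y (l - 1)) * degree G1"
  \<comment> \<open>\<open>g0\<close> and \<open>lc\<close> are Laurent series, so their subdegrees
    are integers; comparing exponents of q gives the divisibility by r.\<close>
  have "fls_subdegree lc * int r - int m = fls_subdegree g0 * int r"
  proof -
    have "real CARD('a) powi (- (fls_subdegree g0 * int r))
        = real CARD('a) powi (- (fls_subdegree lc * int r)) * real CARD('a) powi int m"
      using eq[folded m_def] lc \<open>g0 \<noteq> 0\<close> by (simp add: fls_abs_def power_int_power')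
    also have "\<dots> = real CARD('a) powi (- (fls_subdegree lc * int r) + int m)"
      using q_gt_1 by (intro power_int_add[symmetric]) auto
    finally have "- (fls_subdegree g0 * int r) = - (fls_subdegree lc * int r) + int m"
      using q_gt_1 power_int_strict_increasing[of _ _ "real CARD('a)"] by (metis less_irrefl linorder_less_linear)
    then show ?thesis by simp
  qed
  then have "int m = int r * (fls_subdegree lc - fls_subdegree g0)"
    by (simp add: algebra_simps)
  then have "int r dvd int m" by simp
  then have "r dvd (Y l - Y (l - 1)) * degree G1" by (simp only: int_dvd_int_iff m_def)
  \<comment> \<open>Since k > 0, p divides Y_l = p^k Y_0 but not Y_(l-1), so it does not divide
    their difference.\<close>
  moreover have "coprime r (Y l - Y (l - 1))"
  proof -
    have "p dvd Y l" using Y_shift[of 0] k by simp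
    moreover have "Y (l - 1) < Y l" using Y_Suc[of "l - 1"] l by simp
    ultimately have "\<not> p dvd Y l - Y (l - 1)" using pY by (metis dvd_diffD1 less_imp_le)
    then show ?thesis unfolding r_def using p by (simp add: prime_imp_coprime)
  qed
  ultimately have "r dvd degree G1" by (simp add: coprime_dvd_mult_right_iff)
  moreover have "0 < degree G1" "degree G1 \<le> r" using deg_G1 deg_ge deg_le by auto
  ultimately have "degree G1 = r" using dvd_imp_le le_antisym by blast
  then show ?thesis using deg_G1 by (simp add: alg_degree_def M_def r_def)
qed

end

text \<open>Translation by 1 permutes the field, so summing all elements shows that the cardinality
  is 0 in the field.\<close>

lemma CHAR_eq_of_CARD:
  assumes "prime p" "CARD('a::{field,finite}) = p ^ m"
  shows "CHAR('a) = p"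
proof -
  have "(\<Sum>x\<in>UNIV. x + 1) = (\<Sum>x\<in>UNIV. x :: 'a)"
    by (rule sum.reindex_bij_witness[of _ "\<lambda>x. x - 1" "\<lambda>x. x + 1"]) auto
  then have "of_nat CARD('a) = (0 :: 'a)" by (simp add: sum.distrib)
  then have "CHAR('a) dvd p ^ m" unfolding of_nat_eq_0_iff_char_dvd assms(2) .
  moreover have "prime CHAR('a)"
    by (rule prime_CHAR_semidom, rule finite_imp_CHAR_pos) simp
  ultimately show ?thesis
    using assms(1) by (metis prime_dvd_power primes_dvd_imp_eq)
qed

lemma class_IA_exponents_exist:
  assumes p: "prime p" and CARD: "CARD('a::{field,finite}) = p ^ m"
    and d: "1 \<le> d" and w: "w \<in> \<rat>" "2 * real d - 1 < w"
  obtains k and \<xi> :: "'a::{field,finite} fls" where "k0 < k" "class_IA p \<xi>" "algebraic_T (to_ac \<xi>)"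
    "alg_degree (to_ac \<xi>) = p ^ k + 1"
    "\<And>n. n \<in> {1..d} \<Longrightarrow> w_exp n \<xi> = ereal w \<and> w_star_exp n \<xi> = ereal w"
proof -
  obtain k l and Y :: "nat \<Rightarrow> nat" where "k0 < k" and Y: "0 < l" "strict_mono Y"
    "\<And>n. Y (n + l) = p ^ k * Y n" "\<not> p dvd Y (l - 1)"
    "\<And>n. real (Y (Suc n)) \<le> w * real (Y n)" "\<And>j. real (Y (Suc (j * l))) = w * real (Y (j * l))"
    "\<And>n. real d * real (Y (Suc n)) \<le> w * (real (Y (Suc n)) - (real d - 1) * real (Y n))"
    using degree_sequence_exists[OF p w(1) d w(2)] by metis
  define a :: "nat \<Rightarrow> 'a poly" where "a n = Polynomial.monom 1 (Y (Suc n) - Y n)" for n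
  interpret fast_continued_fraction p k l Y a d w
    by standard (use a_def p CHAR_eq_of_CARD[OF p CARD] d w Y in auto)
  show ?thesis
    using that[OF \<open>k0 < k\<close> class_IA_\<xi>[OF \<xi>_notin_rat_funs] algebraic_\<xi> alg_degree_\<xi>]
      w_exp_\<xi> w_star_exp_\<xi> \<open>k0 < k\<close> Y(4) by blast
qed

theorem theorem2p1:
  fixes p q m d :: nat and w :: real
  assumes "Factorial_Ring.prime p" and "m \<ge> 1" and "q = p ^ m"
    and "CARD('a::{field,finite}) = q"
    and "d \<ge> 1" and "w \<in> \<rat>" and "w > 2 * real d - 1"
  shows "\<exists>(k :: nat \<Rightarrow> nat) (\<xi> :: nat \<Rightarrow> 'a fls).
           strict_mono_on {1..} k \<and>
           (\<forall>j\<ge>1. k j > 0 \<and>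
              class_IA p (\<xi> j) \<and>
              algebraic_T (to_ac (\<xi> j)) \<and> alg_degree (to_ac (\<xi> j)) = p ^ k j + 1 \<and>
              (\<forall>n\<in>{1..d}. w_exp n (\<xi> j) = ereal w \<and> w_star_exp n (\<xi> j) = ereal w))"
proof -
  define good where "good k \<xi> \<longleftrightarrow> k > 0 \<and> class_IA p \<xi> \<and> algebraic_T (to_ac \<xi>) \<and>
    alg_degree (to_ac \<xi>) = p ^ k + 1 \<and>
    (\<forall>n\<in>{1..d}. w_exp n \<xi> = ereal w \<and> w_star_exp n \<xi> = ereal w)" for k and \<xi> :: "'a fls"
  \<comment> \<open>The exponents k that occur are unbounded since \<open>k0\<close> is arbitrary,
    so this set is infinite and its increasing enumeration is the required sequence.\<close>
  define K where "K = {k. \<exists>\<xi>. good k \<xi>}"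
  have "\<exists>k>k0. k \<in> K" for k0
  proof -
    have "CARD('a) = p ^ m" using assms by simp
    from class_IA_exponents_exist[OF assms(1) this assms(5-7), of k0]
    obtain k and \<xi> :: "'a fls" where "k0 < k" "good k \<xi>"
      unfolding good_def by (metis gr_zeroI less_nat_zero_code)
    then show ?thesis by (auto simp: K_def)
  qed
  then have "infinite K" by (simp add: infinite_nat_iff_unbounded)
  then have mono: "strict_mono (enumerate K)" and "\<And>j. enumerate K j \<in> K"
    by (auto intro: strict_mono_enumerate enumerate_in_set)
  then have "\<forall>j. \<exists>\<xi>. good (enumerate K j) \<xi>" by (auto simp: K_def)
  then obtain \<xi> where "\<And>j. good (enumerate K j) (\<xi> j)" by metis
  moreover have "strict_mono_on {1..} (enumerate K)"
    using mono by (simp add: strict_mono_on_def strict_mono_def)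
  ultimately show ?thesis unfolding good_def by blast
qed

end
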